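(* Let $(X,w)$ be a weighted graph with $n$ vertices and let $R$ be an (additive) abelian group. Suppose that we are given a subgroup $R_x$ of $R$ for every nonempty $x\in X$, and set $R_\emptyset=\{0_R\}$. Define a subsheaf $\mathcal{G}$ of the constant sheaf $R_X$ by $\mathcal{G}(x)=\sum_{y\subseteq x}R_y$ ($x\in X$), and put $$t=\max\Big\{\tfrac{w(e)}{w(x)} : x\in X(0),\ e\in X(1),\ e\supseteq x\Big\},\qquad s=\max\{w(e): e\in X(1)\}.$$ Suppose that: (1) for every subgraph $Y$ of $X$ which is either a cycle of length $\leq\lceil\frac23 n\rceil$ or a path of length $\leq 2$, the subgroups $\{R_y\}_{y\in Y}$ are linearly disjoint in $R$; and (2) for every distinct $u,v\in X(0)$, the subgroups $R_u$ and $R_v$ are linearly disjoint. If $(X,w)$ is a $[\mu,\lambda]$-spectral expander ($\mu,\lambda\in\mathbb{R}$), then $$\mathrm{cbe}_0(X,w,R_X/\mathcal{G})\;\geq\;\frac{2-4\lambda-4\max\{|\lambda|,|\mu|\}-5t-2s}{5-2\lambda}.$$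
   Context: A graph is a finite simplicial complex $X$ of dimension at most $1$ (a nonempty finite family of finite sets closed under taking subsets, so $\emptyset\in X$). $X(i)$ denotes the set of faces of dimension $i$ (cardinality $i+1$); $X(0)$ is the set of vertices and $X(1)$ the set of edges. A weighted graph is a pair $(X,w)$ where $X$ is a graph that is pure of dimension $1$ (every face is contained in an edge) and $w:X\to[0,\infty)$ satisfies $\sum_{e\in X(1)}w(e)=1$, $w(v)=\frac12\sum_{e\in X(1),\,e\supseteq v}w(e)$ for all $v\in X(0)$, $w(\emptyset)=1$, and $w(v)>0$ for all $v\in X(0)$. For $A\subseteq X$, $w(A)=\sum_{a\in A}w(a)$. A subgraph of $X$ is a subset of $X$ that is itself a graph (so it contains $\emptyset$). A cycle of length $\ell\ge 3$ is a subgraph isomorphic to the cycle graph on $\ell$ vertices; a path of length $\ell$ is a subgraph consisting of $\ell$ distinct consecutive edges, their vertices and $\emptyset$ (so a path of length $\le 2$ is a single vertex, an edge with its two vertices, or two distinct edges sharing a vertex together with their three vertices, in each case along with $\emptyset$). A finite family of subgroups $\{R_i\}_{i\in I}$ of $R$ is linearly disjoint if $(r_i)_i\mapsto\sum_i r_i:\bigoplus_{i\in I}R_i\to R$ is injective. Spectral expansion: on functions $f:X(0)\to\mathbb{R}$ with inner product $\langle f,g\rangle=\sum_{v}w(v)f(v)g(v)$, the weighted adjacency operator is $(\mathcal{A}f)(v)=\sum_{e\in X(1),\,e\supseteq v}\frac{w(e)}{2w(v)}f(e-v)$, where $e-v$ is the other vertex of $e$. It is self-adjoint and preserves $C^0_\circ(X,\mathbb{R})=\{f:\sum_v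 w(v)f(v)=0\}$. For real numbers $\mu\le\lambda$, $(X,w)$ is a $[\mu,\lambda]$-spectral expander (or $[\mu,\lambda]$-expander) if all eigenvalues of $\mathcal{A}$ on $C^0_\circ(X,\mathbb{R})$ lie in $[\mu,\lambda]$. Sheaves: a sheaf $\mathcal{F}$ on $X$ assigns an abelian group $\mathcal{F}(x)$ to each $x\in X$ (including $\emptyset$) and homomorphisms $\mathrm{res}_{y\leftarrow x}:\mathcal{F}(x)\to\mathcal{F}(y)$ for $x\subsetneq y$ with $\mathrm{res}_{z\leftarrow y}\circ\mathrm{res}_{y\leftarrow x}=\mathrm{res}_{z\leftarrow x}$. The constant sheaf $R_X$ has $R_X(x)=R$ for all $x$ and identity restriction maps. A subsheaf $\mathcal{G}\subseteq R_X$ is a choice of subgroups $\mathcal{G}(x)\subseteq R$ with $\mathcal{G}(x)\subseteq\mathcal{G}(y)$ for $x\subseteq y$; the quotient sheaf $R_X/\mathcal{G}$ has $(R_X/\mathcal{G})(x)=R/\mathcal{G}(x)$ with the induced restriction maps. Coboundary expansion: fix a linear order on the vertices and let $e^+,e^-$ be the larger and smaller vertex of $e$. Put $C^i=\prod_{x\in X(i)}\mathcal{F}(x)$, $(d_{-1}f)(v)=\mathrm{res}_{v\leftarrow\emptyset}f(\emptyset)$, $(d_0f)(e)=\mathrm{res}_{e\leftarrow e^+}f(e^+)-\mathrm{res}_{e\leftarrow e^-}f(e^-)$, $B^0=\mathrm{im}\,d_{-1}$. For $f\in C^i$, $\|f\|_w=w(\{x\in X(i):f(x)\ne0\})$; $\mathrm{dist}_w(f,B^0)=\min_{g\in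 B^0}\|f-g\|_w$. $\mathrm{cbe}_0(X,w,\mathcal{F})$ is the supremum of all $\varepsilon\in[0,\infty)$ with $\|d_0f\|_w\ge\varepsilon\,\mathrm{dist}_w(f,B^0)$ for all $f\in C^0$.
   Formalization: The formal statement additionally assumes λ < 5/2, so that the denominator 5−2λ is positive; for larger λ the bound is false (e.g. the uniform complete graph on 4 vertices with R=ℤ, all R_x=0, viewed as a [−1,10]-expander), and at λ = 5/2 it is undefined. *)

theory Defs
  imports Complex_Main "HOL-Library.Extended_Real" "HOL-Algebra.Product_Groups" "HOL-Algebra.FiniteProduct"
begin

section \<open>Graphs\<close>

text \<open>A graph is a simplicial complex of dimension at most 1, given as the set of its faces,
  the empty face included. Vertices and edges are faces: a vertex is a singleton.\<close>

definition graph :: "'a set set \<Rightarrow> bool" where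
  "graph X \<longleftrightarrow> X \<noteq> {} \<and> finite X \<and> (\<forall>x\<in>X. finite x \<and> card x \<le> 2) \<and> (\<forall>x\<in>X. \<forall>y. y \<subseteq> x \<longrightarrow> y \<in> X)"

definition faces :: "'a set set \<Rightarrow> nat \<Rightarrow> 'a set set" where
  "faces X i = {x \<in> X. card x = i + 1}"

definition weighted_graph :: "'a set set \<Rightarrow> ('a set \<Rightarrow> real) \<Rightarrow> bool" where
  "weighted_graph X w \<longleftrightarrow>
     graph X \<and> (\<forall>x\<in>X. \<exists>e\<in>faces X 1. x \<subseteq> e) \<and>
     (\<forall>x\<in>X. 0 \<le> w x) \<and>
     (\<Sum>e\<in>faces X 1. w e) = 1 \<and>
     (\<forall>v\<in>faces X 0. w v = 1/2 * (\<Sum>e | e \<in> faces X 1 \<and> v \<subseteq> e. w e)) \<and>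
     w {} = 1 \<and>
     (\<forall>v\<in>faces X 0. 0 < w v)"

definition subgraph :: "'a set set \<Rightarrow> 'a set set \<Rightarrow> bool" where
  "subgraph Y X \<longleftrightarrow> graph Y \<and> Y \<subseteq> X"

definition graph_isomorphic :: "'a set set \<Rightarrow> 'b set set \<Rightarrow> bool" where
  "graph_isomorphic X Y \<longleftrightarrow> (\<exists>\<phi>. bij_betw \<phi> (\<Union>X) (\<Union>Y) \<and> (\<lambda>x. \<phi> ` x) ` X = Y)"

definition cycle_graph :: "nat \<Rightarrow> nat set set" where
  "cycle_graph l = {{}} \<union> (\<lambda>i. {i}) ` {..<l} \<union> (\<lambda>i. {i, (i + 1) mod l}) ` {..<l}"

definition cycle_of_length :: "'a set set \<Rightarrow> nat \<Rightarrow> 'a set set \<Rightarrow> bool" where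
  "cycle_of_length X l Y \<longleftrightarrow> l \<ge> 3 \<and> subgraph Y X \<and> graph_isomorphic (cycle_graph l) Y"

text \<open>The list \<^term>\<open>vs\<close> enumerates the l + 1 successive vertices along the path; the l edges
  between consecutive ones have to be genuine edges and pairwise distinct.\<close>

definition path_of_length :: "'a set set \<Rightarrow> nat \<Rightarrow> 'a set set \<Rightarrow> bool" where
  "path_of_length X l Y \<longleftrightarrow> subgraph Y X \<and>
     (\<exists>vs. length vs = l + 1 \<and>
        (\<forall>i<l. vs ! i \<noteq> vs ! (i + 1)) \<and>
        inj_on (\<lambda>i. {vs ! i, vs ! (i + 1)}) {..<l} \<and>
        Y = {{}} \<union> (\<lambda>v. {v}) ` set vs \<union> (\<lambda>i. {vs ! i, vs ! (i + 1)}) ` {..<l})"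


section \<open>Spectral expansion\<close>

text \<open>Functions on the vertex set have type \<^typ>\<open>'a set \<Rightarrow> real\<close>; only their values on
  \<^term>\<open>faces X 0\<close> matter. The vertex of \<open>e\<close> other than \<open>v\<close> is the set difference
  \<^term>\<open>e - v\<close>.\<close>

definition adjacency_op :: "'a set set \<Rightarrow> ('a set \<Rightarrow> real) \<Rightarrow> ('a set \<Rightarrow> real) \<Rightarrow> 'a set \<Rightarrow> real" where
  "adjacency_op X w f v = (\<Sum>e | e \<in> faces X 1 \<and> v \<subseteq> e. w e / (2 * w v) * f (e - v))"

text \<open>The eigenvalues of the adjacency operator on the space of functions of weighted mean 0.\<close>

definition eigenvalue_mean0 :: "'a set set \<Rightarrow> ('a set \<Rightarrow> real) \<Rightarrow> real \<Rightarrow> bool" where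
  "eigenvalue_mean0 X w \<nu> \<longleftrightarrow>
     (\<exists>f. (\<Sum>v\<in>faces X 0. w v * f v) = 0 \<and> (\<exists>v\<in>faces X 0. f v \<noteq> 0) \<and>
          (\<forall>v\<in>faces X 0. adjacency_op X w f v = \<nu> * f v))"

definition spectral_expander :: "'a set set \<Rightarrow> ('a set \<Rightarrow> real) \<Rightarrow> real \<Rightarrow> real \<Rightarrow> bool" where
  "spectral_expander X w \<mu> \<kappa> \<longleftrightarrow> \<mu> \<le> \<kappa> \<and> (\<forall>\<nu>. eigenvalue_mean0 X w \<nu> \<longrightarrow> \<nu> \<in> {\<mu>..\<kappa>})"


section \<open>Sheaves\<close>

text \<open>Abelian groups are commutative groups in the sense of HOL-Algebra and hence written
  multiplicatively: sums are products, 0 is \<open>\<one>\<close>, and \<open>a - b\<close> is \<open>a \<otimes> inv b\<close>.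
  The map \<open>res F x y\<close> goes from the group at \<open>x\<close> to the group at \<open>y\<close>.\<close>

record ('a, 'b) sheaf_data =
  grp :: "'a set \<Rightarrow> 'b monoid"
  res :: "'a set \<Rightarrow> 'a set \<Rightarrow> 'b \<Rightarrow> 'b"

definition sheaf :: "'a set set \<Rightarrow> ('a, 'b) sheaf_data \<Rightarrow> bool" where
  "sheaf X F \<longleftrightarrow>
     (\<forall>x\<in>X. comm_group (grp F x)) \<and>
     (\<forall>x\<in>X. \<forall>y\<in>X. x \<subset> y \<longrightarrow> res F x y \<in> hom (grp F x) (grp F y)) \<and>
     (\<forall>x\<in>X. \<forall>y\<in>X. \<forall>z\<in>X. x \<subset> y \<longrightarrow> y \<subset> z \<longrightarrow>
        (\<forall>a\<in>carrier (grp F x). res F y z (res F x y a) = res F x z a))"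

definition const_sheaf :: "'b monoid \<Rightarrow> ('a, 'b) sheaf_data" where
  "const_sheaf R = \<lparr>grp = (\<lambda>_. R), res = (\<lambda>_ _ a. a)\<rparr>"

definition const_subsheaf :: "'a set set \<Rightarrow> 'b monoid \<Rightarrow> ('a set \<Rightarrow> 'b set) \<Rightarrow> bool" where
  "const_subsheaf X R G \<longleftrightarrow>
     (\<forall>x\<in>X. subgroup (G x) R) \<and> (\<forall>x\<in>X. \<forall>y\<in>X. x \<subseteq> y \<longrightarrow> G x \<subseteq> G y)"

text \<open>The coset \<open>a + G x\<close> is sent to \<open>res F x y a + G y\<close>, which is the setwise sum of \<open>G y\<close> and
  the image of the coset.\<close>

definition quotient_sheaf ::
    "('a, 'b) sheaf_data \<Rightarrow> ('a set \<Rightarrow> 'b set) \<Rightarrow> ('a, 'b set) sheaf_data" where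
  "quotient_sheaf F G =
     \<lparr>grp = (\<lambda>x. grp F x Mod G x),
      res = (\<lambda>x y C. G y <#>\<^bsub>grp F y\<^esub> (res F x y ` C))\<rparr>"


section \<open>Families of subgroups\<close>

text \<open>For finite \<open>I\<close>, the direct sum of the \<open>S i\<close> is the full product \<^term>\<open>Pi\<^sub>E I S\<close>.
  It is indexed by \<open>I\<close>, so that distinct indices with equal subgroups count separately.\<close>

definition linearly_disjoint :: "('b, 'm) monoid_scheme \<Rightarrow> ('i \<Rightarrow> 'b set) \<Rightarrow> 'i set \<Rightarrow> bool" where
  "linearly_disjoint R S I \<longleftrightarrow> inj_on (\<lambda>r. finprod R r I) (Pi\<^sub>E I S)"

definition subgroup_sum :: "('b, 'm) monoid_scheme \<Rightarrow> ('i \<Rightarrow> 'b set) \<Rightarrow> 'i set \<Rightarrow> 'b set" where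
  "subgroup_sum R S I = (\<lambda>r. finprod R r I) ` (Pi\<^sub>E I S)"


section \<open>Coboundary expansion in dimension 0\<close>

definition cochains :: "'a set set \<Rightarrow> ('a, 'b) sheaf_data \<Rightarrow> nat \<Rightarrow> ('a set \<Rightarrow> 'b) monoid" where
  "cochains X F i = product_group (faces X i) (grp F)"

definition d_minus1 :: "'a set set \<Rightarrow> ('a, 'b) sheaf_data \<Rightarrow> 'b \<Rightarrow> 'a set \<Rightarrow> 'b" where
  "d_minus1 X F a = (\<lambda>v\<in>faces X 0. res F {} v a)"

text \<open>The fixed linear order on the vertices is that of the class \<^class>\<open>linorder\<close>.\<close>

definition d0 :: "('a::linorder) set set \<Rightarrow> ('a, 'b) sheaf_data \<Rightarrow> ('a set \<Rightarrow> 'b) \<Rightarrow> 'a set \<Rightarrow> 'b" where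
  "d0 X F f = (\<lambda>e\<in>faces X 1.
     res F {Max e} e (f {Max e}) \<otimes>\<^bsub>grp F e\<^esub> inv\<^bsub>grp F e\<^esub> (res F {Min e} e (f {Min e})))"

definition B0 :: "'a set set \<Rightarrow> ('a, 'b) sheaf_data \<Rightarrow> ('a set \<Rightarrow> 'b) set" where
  "B0 X F = d_minus1 X F ` carrier (grp F {})"

definition cochain_norm ::
    "'a set set \<Rightarrow> ('a set \<Rightarrow> real) \<Rightarrow> ('a, 'b) sheaf_data \<Rightarrow> nat \<Rightarrow> ('a set \<Rightarrow> 'b) \<Rightarrow> real" where
  "cochain_norm X w F i f = (\<Sum>x | x \<in> faces X i \<and> f x \<noteq> \<one>\<^bsub>grp F x\<^esub>. w x)"

text \<open>\<^term>\<open>B0 X F\<close> may be infinite, but the norm takes only finitely many values, so that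
  \<^const>\<open>Min\<close> is meaningful.\<close>

definition dist_B0 ::
    "'a set set \<Rightarrow> ('a set \<Rightarrow> real) \<Rightarrow> ('a, 'b) sheaf_data \<Rightarrow> ('a set \<Rightarrow> 'b) \<Rightarrow> real" where
  "dist_B0 X w F f =
     Min ((\<lambda>g. cochain_norm X w F 0 (f \<otimes>\<^bsub>cochains X F 0\<^esub> inv\<^bsub>cochains X F 0\<^esub> g)) ` B0 X F)"

text \<open>The supremum is taken in the extended reals because it is infinite if every 0-cochain
  is a coboundary.\<close>

definition cbe0 ::
    "('a::linorder) set set \<Rightarrow> ('a set \<Rightarrow> real) \<Rightarrow> ('a, 'b) sheaf_data \<Rightarrow> ereal" where
  "cbe0 X w F =
     Sup {ereal \<epsilon> |\<epsilon>. 0 \<le> \<epsilon> \<and>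
       (\<forall>f\<in>carrier (cochains X F 0). \<epsilon> * dist_B0 X w F f \<le> cochain_norm X w F 1 (d0 X F f))}"


section \<open>Consistency of the constructions\<close>

lemma finite_cochain_norm_image:
  assumes "graph X" shows "finite (cochain_norm X w F i ` A)"
proof (rule finite_subset)
  have "finite (faces X i)" using assms by (simp add: graph_def faces_def)
  then show "finite (sum w ` Pow (faces X i))" by simp
  show "cochain_norm X w F i ` A \<subseteq> sum w ` Pow (faces X i)"
    unfolding cochain_norm_def by blast
qed

lemma sheaf_const_sheaf:
  assumes "comm_group R" shows "sheaf X (const_sheaf R)"
  using assms by (simp add: sheaf_def const_sheaf_def hom_def)

lemma (in comm_group) subgroup_subgroup_sum:
  assumes S: "\<And>i. i \<in> I \<Longrightarrow> subgroup (S i) G"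
  shows "subgroup (subgroup_sum G S I) G"
proof -
  have in_carrier: "r \<in> I \<rightarrow> carrier G" if "r \<in> Pi\<^sub>E I S" for r
    using that subgroup.subset[OF S] by (fastforce simp: PiE_def Pi_def)
  show ?thesis
  proof (rule subgroupI)
    show "subgroup_sum G S I \<subseteq> carrier G"
      using in_carrier by (auto simp: subgroup_sum_def intro!: finprod_closed)
    have "(\<lambda>i\<in>I. \<one>) \<in> Pi\<^sub>E I S"
      using subgroup.one_closed[OF S] by auto
    then show "subgroup_sum G S I \<noteq> {}" unfolding subgroup_sum_def by blast
  next
    fix a assume "a \<in> subgroup_sum G S I"
    then obtain r where r: "r \<in> Pi\<^sub>E I S" "a = finprod G r I"
      by (auto simp: subgroup_sum_def)
    let ?r = "\<lambda>i\<in>I. inv (r i)"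
    have r': "?r \<in> Pi\<^sub>E I S"
      using r(1) subgroup.m_inv_closed[OF S] by (auto simp: PiE_iff)
    have "finprod G ?r I \<otimes> a = finprod G (\<lambda>i. ?r i \<otimes> r i) I"
      unfolding r(2) by (rule finprod_multf[symmetric]) (fact in_carrier[OF r'] in_carrier[OF r(1)])+
    also have "\<dots> = finprod G (\<lambda>i. \<one>) I"
      using in_carrier[OF r(1)] by (intro finprod_cong') (auto simp: Pi_iff)
    finally have "finprod G ?r I = inv a"
      using r in_carrier[OF r(1)] in_carrier[OF r']
      by (metis finprod_closed finprod_one_eqI inv_equality)
    then show "inv a \<in> subgroup_sum G S I"
      using r' unfolding subgroup_sum_def by (metis image_eqI)
  next
    fix a b assume "a \<in> subgroup_sum G S I" "b \<in> subgroup_sum G S I"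
    then obtain r q where r: "r \<in> Pi\<^sub>E I S" "a = finprod G r I"
      and q: "q \<in> Pi\<^sub>E I S" "b = finprod G q I"
      by (auto simp: subgroup_sum_def)
    let ?p = "\<lambda>i\<in>I. r i \<otimes> q i"
    have p: "?p \<in> Pi\<^sub>E I S"
      using r(1) q(1) subgroup.m_closed[OF S] by (auto simp: PiE_iff)
    have "a \<otimes> b = finprod G (\<lambda>i. r i \<otimes> q i) I"
      unfolding r(2) q(2)
      by (rule finprod_multf[symmetric]) (fact in_carrier[OF r(1)] in_carrier[OF q(1)])+
    also have "\<dots> = finprod G ?p I"
      using in_carrier[OF r(1)] in_carrier[OF q(1)] by (intro finprod_cong') (auto simp: Pi_iff)
    finally show "a \<otimes> b \<in> subgroup_sum G S I"
      using p unfolding subgroup_sum_def by blast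
  qed
qed

lemma (in comm_group) subgroup_sum_mono:
  assumes S: "\<And>i. i \<in> J \<Longrightarrow> subgroup (S i) G" and "I \<subseteq> J" "finite J"
  shows "subgroup_sum G S I \<subseteq> subgroup_sum G S J"
proof
  fix a assume "a \<in> subgroup_sum G S I"
  then obtain r where r: "r \<in> Pi\<^sub>E I S" "a = finprod G r I"
    by (auto simp: subgroup_sum_def)
  let ?r = "\<lambda>i\<in>J. if i \<in> I then r i else \<one>"
  have r': "?r \<in> Pi\<^sub>E J S"
    using r(1) subgroup.one_closed[OF S] by (auto simp: PiE_iff)
  have c: "?r \<in> J \<rightarrow> carrier G"
    using r' subgroup.subset[OF S] by (fastforce simp: PiE_def Pi_def)
  have "finprod G r I = finprod G ?r I"
    using c assms(2) by (intro finprod_cong') (auto simp: Pi_iff)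
  also have "\<dots> = finprod G ?r J"
    using c assms by (intro finprod_mono_neutral_cong_left) auto
  finally show "a \<in> subgroup_sum G S J"
    using r r' unfolding subgroup_sum_def by blast
qed

lemma const_subsheaf_subgroup_sum:
  assumes "comm_group R" "graph X" and S: "\<And>x. x \<in> X \<Longrightarrow> subgroup (S x) R"
  shows "const_subsheaf X R (\<lambda>x. subgroup_sum R S {y \<in> X. y \<subseteq> x})"
proof -
  interpret comm_group R by fact
  have "finite X" using assms by (simp add: graph_def)
  then show ?thesis
    unfolding const_subsheaf_def
    by (intro conjI ballI impI subgroup_subgroup_sum subgroup_sum_mono) (auto intro: S)
qed

lemma sheaf_quotient_sheaf:
  assumes "comm_group R" and G: "const_subsheaf X R G"
  shows "sheaf X (quotient_sheaf (const_sheaf R) G)"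
    and "\<And>x y a. x \<in> X \<Longrightarrow> y \<in> X \<Longrightarrow> x \<subseteq> y \<Longrightarrow> a \<in> carrier R \<Longrightarrow>
      res (quotient_sheaf (const_sheaf R) G) x y (G x #>\<^bsub>R\<^esub> a) = G y #>\<^bsub>R\<^esub> a"
proof -
  interpret comm_group R by fact
  let ?Q = "quotient_sheaf (const_sheaf R) G"
  have sub: "subgroup (G x) R" if "x \<in> X" for x
    using G that by (simp add: const_subsheaf_def)
  have nor: "normal (G x) R" if "x \<in> X" for x
    using sub[OF that] by (simp add: subgroup_imp_normal)
  have grp: "grp ?Q x = R Mod G x" for x
    by (simp add: quotient_sheaf_def const_sheaf_def)
  have res: "res ?Q x y (G x #>\<^bsub>R\<^esub> a) = G y #>\<^bsub>R\<^esub> a"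
    if "x \<in> X" "y \<in> X" "x \<subseteq> y" "a \<in> carrier R" for x y a
  proof -
    have le: "G x \<subseteq> G y" using G that by (auto simp: const_subsheaf_def)
    have "G y <#>\<^bsub>R\<^esub> G x = G y"
    proof
      show "G y <#>\<^bsub>R\<^esub> G x \<subseteq> G y"
        using le subgroup.m_closed[OF sub[OF that(2)]] by (auto simp: set_mult_def)
      show "G y \<subseteq> G y <#>\<^bsub>R\<^esub> G x"
        using subgroup.one_closed[OF sub[OF that(1)]] subgroup.subset[OF sub[OF that(2)]]
        by (force simp: set_mult_def)
    qed
    then have "G y <#>\<^bsub>R\<^esub> (G x #>\<^bsub>R\<^esub> a) = G y #>\<^bsub>R\<^esub> a"
      using that sub subgroup.subset by (metis setmult_rcos_assoc)
    then show ?thesis by (simp add: quotient_sheaf_def const_sheaf_def)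
  qed
  then show "\<And>x y a. x \<in> X \<Longrightarrow> y \<in> X \<Longrightarrow> x \<subseteq> y \<Longrightarrow> a \<in> carrier R \<Longrightarrow>
      res ?Q x y (G x #>\<^bsub>R\<^esub> a) = G y #>\<^bsub>R\<^esub> a" .
  show "sheaf X ?Q"
    unfolding sheaf_def
  proof (intro conjI ballI impI)
    fix x assume "x \<in> X"
    then show "comm_group (grp ?Q x)" by (simp add: grp sub abelian_FactGroup)
  next
    fix x y assume xy: "x \<in> X" "y \<in> X" "x \<subset> y"
    then have le: "x \<subseteq> y" by simp
    show "res ?Q x y \<in> hom (grp ?Q x) (grp ?Q y)"
    proof (rule homI)
      fix C assume "C \<in> carrier (grp ?Q x)"
      then show "res ?Q x y C \<in> carrier (grp ?Q y)"
        using res[OF xy(1,2) le] by (auto simp: grp carrier_FactGroup)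
    next
      fix C D assume "C \<in> carrier (grp ?Q x)" "D \<in> carrier (grp ?Q x)"
      then obtain a b where "C = G x #>\<^bsub>R\<^esub> a" "D = G x #>\<^bsub>R\<^esub> b" "a \<in> carrier R" "b \<in> carrier R"
        by (auto simp: grp carrier_FactGroup)
      then show "res ?Q x y (C \<otimes>\<^bsub>grp ?Q x\<^esub> D) = res ?Q x y C \<otimes>\<^bsub>grp ?Q y\<^esub> res ?Q x y D"
        using res[OF xy(1,2) le] nor xy by (simp add: grp normal.rcos_sum)
    qed
  next
    fix x y z C
    assume "x \<in> X" "y \<in> X" "z \<in> X" "x \<subset> y" "y \<subset> z" "C \<in> carrier (grp ?Q x)"
    then show "res ?Q y z (res ?Q x y C) = res ?Q x z C"
      by (auto simp: grp carrier_FactGroup res)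
  qed
qed

end

theory Submission
  imports Defs "HOL-Analysis.Function_Topology"
begin

text \<open>
  A 0-cochain \<open>f\<close> assigns to each vertex \<open>v\<close> a coset \<open>L v\<close>, viewed as a list of admissible
  constants. Linear disjointness makes \<open>f\<close> constant along every short cycle of edges killed by
  \<open>d0\<close> (good edges), and two distinct lists share at most one constant. Take a smallest set \<open>H\<close> of
  good edges that contains all good edges without a common constant and still connects, for every
  constant \<open>g\<close>, whatever the good edges with common constant \<open>g\<close> connect. A short cycle in \<open>H\<close>
  would be redundant, so \<open>H\<close> has none and hence at most one independent cycle per component; so it
  can be oriented with out-degree at most 1. Colouring \<open>v\<close> by the constant of its out-edge, the good
  edges that are not inside a colour class have total weight at most \<open>t\<close>. By the spectral mixing
  bound some constant \<open>g\<close> is then admissible on a set \<open>A\<close> of large weight. A vertex outside \<open>A\<close> has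
  at most one good edge into \<open>A\<close>, by disjointness on paths of length 2, so nearly all of the edge
  boundary of \<open>A\<close>, which expansion makes heavy, consists of edges not killed by \<open>d0\<close>.
\<close>

section \<open>Orienting graphs without short cycles\<close>

definition edges_path :: "'a set set \<Rightarrow> 'a list \<Rightarrow> bool" where
  "edges_path E p \<longleftrightarrow> distinct p \<and> successively (\<lambda>x y. {x, y} \<in> E) p"

definition edges_cycle :: "'a set set \<Rightarrow> 'a list \<Rightarrow> bool" where
  "edges_cycle E p \<longleftrightarrow> 3 \<le> length p \<and> edges_path E p \<and> {last p, hd p} \<in> E"

lemma edges_path_mono: "edges_path E p \<Longrightarrow> E \<subseteq> F \<Longrightarrow> edges_path F p"
  unfolding edges_path_def by (blast intro: successively_mono)

lemma edges_cycle_mono: "edges_cycle E p \<Longrightarrow> E \<subseteq> F \<Longrightarrow> edges_cycle F p"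
  unfolding edges_cycle_def by (blast intro: edges_path_mono)

lemma edges_path_take: "edges_path E p \<Longrightarrow> edges_path E (take m p)"
  by (metis append_take_drop_id distinct_take edges_path_def successively_append_iff)

lemma edges_path_drop: "edges_path E p \<Longrightarrow> edges_path E (drop m p)"
  by (metis append_take_drop_id distinct_drop edges_path_def successively_append_iff)

lemma edges_path_rev: "edges_path E (rev p) = edges_path E p"
  by (simp add: edges_path_def insert_commute)

lemma edges_path_append:
  assumes "p \<noteq> []" "q \<noteq> []"
  shows "edges_path E (p @ q) \<longleftrightarrow>
    edges_path E p \<and> edges_path E q \<and> set p \<inter> set q = {} \<and> {last p, hd q} \<in> E"
  using assms by (auto simp: edges_path_def successively_append_iff)

lemma edges_cycle_rotate:
  assumes "edges_cycle E p"
  shows "edges_cycle E (rotate m p)"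
proof (induction m)
  case 0 show ?case using assms by simp
next
  case (Suc m)
  define q where "q = rotate m p"
  have q: "edges_cycle E q" using Suc by (simp add: q_def)
  then obtain x q' where eq: "q = x # q'" "q' \<noteq> []"
    by (cases q; cases "tl q") (auto simp: edges_cycle_def)
  have "edges_cycle E (rotate1 q)"
    using q eq by (cases q')
      (auto simp: edges_cycle_def edges_path_def successively_append_iff
        simp flip: append_Cons)
  then show ?case by (simp add: q_def)
qed

text \<open>The two chords at the ends of a longest path, together with the path, form a theta graph or
  two cycles with at most one common vertex, whose shortest cycle is short.\<close>

lemma longest_path_closes:
  assumes p: "edges_path E p" and len: "length p \<le> N"
    and chord0: "{hd p, p ! i} \<in> E" "2 \<le> i" "i < length p"
    and chord1: "{last p, p ! j} \<in> E" "j + 2 < length p"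
    and no: "\<And>q. edges_cycle E q \<Longrightarrow> 2 * (N + 1) < 3 * length q"
  shows "i + 1 = length p"
proof (rule ccontr)
  assume ne: "i + 1 \<noteq> length p"
  have "last (take (i + 1) p) = p ! i"
    using chord0 by (subst last_conv_nth) auto
  then have "edges_cycle E (take (i + 1) p)"
    using p chord0 by (auto simp: edges_cycle_def edges_path_take insert_commute)
  then have 1: "2 * (N + 1) < 3 * (i + 1)" using no chord0(3) by fastforce
  have "edges_cycle E (drop j p)"
    using p chord1 by (auto simp: edges_cycle_def edges_path_drop hd_drop_conv_nth)
  then have 2: "2 * (N + 1) < 3 * (length p - j)" using no by fastforce
  show False
  proof (cases "i \<le> j")
    case True
    moreover obtain d where "length p = d + j"
      using chord1 by (metis add.commute add_lessD1 le_add_diff_inverse2 less_imp_le)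
    ultimately show False using 1 2 len by simp
  next
    case False
    let ?q = "take (j + 1) p @ rev (drop i p)"
    have "set (take (j + 1) p) \<inter> set (drop i p) = {}"
      using p False by (intro set_take_disj_set_drop_if_distinct) (auto simp: edges_path_def)
    moreover have "last (take (j + 1) p) = p ! j"
      using chord1 by (subst last_conv_nth) auto
    ultimately have "edges_path E ?q"
      using p chord0 chord1 False
      by (subst edges_path_append)
        (auto simp: edges_path_take edges_path_drop edges_path_rev hd_rev insert_commute)
    moreover have "p \<noteq> []" using chord0(3) by auto
    ultimately have "edges_cycle E ?q"
      using chord0 chord1 False ne
      by (auto simp: edges_cycle_def last_rev hd_drop_conv_nth insert_commute)
    then have "2 * (N + 1) < 3 * (j + 1 + (length p - i))"
      using no[of ?q] chord0 chord1 False by simp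
    moreover obtain a b where "length p = j + a" "length p = i + b"
      using chord0(3) chord1(2) by (metis add_lessD1 le_Suc_ex less_imp_le)
    ultimately show False using 1 2 len by simp
  qed
qed

lemma card2_other:
  assumes "card e = 2" "v \<in> e" obtains u where "e = {v, u}" "u \<noteq> v"
  using assms by (auto simp: card_2_iff)

lemma longest_path_end_edges:
  assumes E: "\<And>e. e \<in> E \<Longrightarrow> e \<subseteq> V \<and> card e = 2"
    and deg: "\<And>v. v \<in> V \<Longrightarrow> \<not> (\<exists>e0. \<forall>e\<in>E. v \<in> e \<longrightarrow> e = e0)"
    and p: "edges_path E p" "set p \<subseteq> V" "p \<noteq> []" and len: "length p \<le> N"
    and longest: "\<And>q. edges_path E q \<Longrightarrow> set q \<subseteq> V \<Longrightarrow> length q \<le> length p"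
    and no: "\<And>q. edges_cycle E q \<Longrightarrow> 2 * (N + 1) < 3 * length q"
  shows "edges_cycle E p" and "\<And>e. e \<in> E \<Longrightarrow> hd p \<in> e \<Longrightarrow> e = {hd p, p ! 1} \<or> e = {hd p, last p}"
proof -
  have end_edge: "\<exists>i. 0 < i \<and> i < length q \<and> e = {hd q, q ! i}"
    if q: "edges_path E q" "set q = set p" "length q = length p" and e: "e \<in> E" "hd q \<in> e" for q e
  proof -
    have ne: "q \<noteq> []" using q p by auto
    obtain y where y: "e = {hd q, y}" "y \<noteq> hd q" using card2_other E e by metis
    have "y \<in> set q"
    proof (rule ccontr)
      assume "y \<notin> set q"
      then have "edges_path E (y # q)"
        using q y e ne by (cases q) (auto simp: edges_path_def insert_commute)
      moreover have "set (y # q) \<subseteq> V" using q p y e E by auto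
      ultimately show False using longest[of "y # q"] q by simp
    qed
    then obtain i where "i < length q" "y = q ! i" by (auto simp: in_set_conv_nth)
    then show ?thesis using y ne by (intro exI[of _ i]) (auto simp: hd_conv_nth intro: gr0I)
  qed
  have far: "\<exists>i. 2 \<le> i \<and> i < length q \<and> {hd q, q ! i} \<in> E"
    if q: "edges_path E q" "set q = set p" "length q = length p" for q
  proof -
    have "hd q \<in> V" using q p by (metis hd_in_set length_0_conv subsetD)
    then obtain e where e: "e \<in> E" "hd q \<in> e" "e \<noteq> {hd q, q ! 1}" using deg by blast
    obtain i where i: "0 < i" "i < length q" "e = {hd q, q ! i}" using end_edge[OF q e(1,2)] by auto
    have "i \<noteq> 1" using i e by auto
    then show ?thesis using i e by (intro exI[of _ i]) auto
  qed
  obtain k where k: "2 \<le> k" "k < length p" "{hd (rev p), rev p ! k} \<in> E"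
    using far[of "rev p"] p by (auto simp: edges_path_rev)
  define j where "j = length p - 1 - k"
  have j: "{last p, p ! j} \<in> E" "j + 2 < length p"
    using k by (auto simp: j_def rev_nth hd_rev)
  have close: "{hd p, p ! i} \<in> E \<Longrightarrow> 2 \<le> i \<Longrightarrow> i < length p \<Longrightarrow> i + 1 = length p" for i
    using longest_path_closes[OF p(1) len _ _ _ j no] .
  have last: "{hd p, p ! i} \<in> E \<Longrightarrow> 2 \<le> i \<Longrightarrow> i < length p \<Longrightarrow> p ! i = last p" for i
    using close[of i] p(3) by (metis add_diff_cancel_right' last_conv_nth)
  show "edges_cycle E p"
    using far[of p] p last j by (auto simp: edges_cycle_def insert_commute)
  fix e assume e: "e \<in> E" "hd p \<in> e"
  obtain i where i: "0 < i" "i < length p" "e = {hd p, p ! i}" using end_edge[OF p(1) _ _ e] by auto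
  then show "e = {hd p, p ! 1} \<or> e = {hd p, last p}"
    using last[of i] e by (cases "i = 1") auto
qed

lemma ex_orientation:
  assumes "finite V" and "\<And>e. e \<in> E \<Longrightarrow> e \<subseteq> V \<and> card e = 2" and "card V \<le> N"
    and "\<And>q. edges_cycle E q \<Longrightarrow> 2 * (N + 1) < 3 * length q"
  shows "\<exists>out. \<forall>e\<in>E. \<exists>v\<in>e. out v = e"
  using assms
proof (induction "card V" arbitrary: V E rule: less_induct)
  case less
  note E = less.prems(2) and no = less.prems(4)
  consider "V = {}" | v e0 where "v \<in> V" "\<forall>e\<in>E. v \<in> e \<longrightarrow> e = e0"
    | "V \<noteq> {}" "\<And>v. v \<in> V \<Longrightarrow> \<not> (\<exists>e0. \<forall>e\<in>E. v \<in> e \<longrightarrow> e = e0)"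
    by blast
  then show ?case
  proof cases
    case 1
    have "e \<notin> E" for e using E[of e] 1 by auto
    then show ?thesis by blast
  next
    case (2 v e0)
    let ?E = "{e \<in> E. v \<notin> e}"
    have "\<exists>out. \<forall>e\<in>?E. \<exists>v\<in>e. out v = e"
    proof (rule less.hyps[of "V - {v}"])
      show "finite (V - {v})" using less.prems by simp
      show "e \<subseteq> V - {v} \<and> card e = 2" if "e \<in> ?E" for e using E that by blast
      show "card (V - {v}) < card V" by (rule card_Diff1_less) (use 2(1) less.prems(1) in auto)
      then show "card (V - {v}) \<le> N" using less.prems by simp
      show "2 * (N + 1) < 3 * length q" if "edges_cycle ?E q" for q
        using no edges_cycle_mono[OF that, of E] by blast
    qed
    then obtain out where out: "\<forall>e\<in>?E. \<exists>v\<in>e. out v = e" by blast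
    have "\<exists>u\<in>e. (out(v := e0)) u = e" if "e \<in> E" for e
    proof (cases "v \<in> e")
      case True
      then have "e = e0" using 2(2) that by blast
      then show ?thesis using True by (metis fun_upd_same)
    next
      case False
      then have e: "e \<in> ?E" using that by simp
      obtain u where "u \<in> e" "out u = e" using bspec[OF out e] by (rule bexE)
      then show ?thesis using False by (metis fun_upd_apply)
    qed
    then show ?thesis by blast
  next
    case 3
    let ?P = "\<lambda>p. edges_path E p \<and> set p \<subseteq> V"
    have bound: "length p \<le> card V" if "?P p" for p
      using that less.prems(1) by (metis card_mono distinct_card edges_path_def)
    obtain v where v: "v \<in> V" using 3 by auto
    have "?P [v]" using v by (simp add: edges_path_def)
    moreover have "\<forall>q. ?P q \<longrightarrow> length q < Suc (card V)" using bound by (simp add: less_Suc_eq_le)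
    ultimately obtain p where p: "?P p" "\<And>q. ?P q \<Longrightarrow> length q \<le> length p"
      using ex_has_greatest_nat[of ?P "[v]" length "Suc (card V)"] by blast
    have ne: "p \<noteq> []" using p(2)[OF \<open>?P [v]\<close>] by auto
    define l where "l = length p"
    have len: "l \<le> N" using bound[OF p(1)] less.prems(3) by (simp add: l_def)
    have closed: "edges_cycle E q"
        "\<And>e. e \<in> E \<Longrightarrow> hd q \<in> e \<Longrightarrow> e = {hd q, q ! 1} \<or> e = {hd q, last q}"
      if "edges_path E q" "set q = set p" "length q = l" for q
    proof -
      have q: "set q \<subseteq> V" "q \<noteq> []" "length q \<le> N" using that p(1) ne len by auto
      have longest: "length q' \<le> length q" if "edges_path E q'" "set q' \<subseteq> V" for q'
        using p(2)[of q'] that \<open>length q = l\<close> by (simp add: l_def)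
      note * = longest_path_end_edges[OF E 3(2) that(1) q longest no]
      show "edges_cycle E q" by (rule *(1))
      show "\<And>e. e \<in> E \<Longrightarrow> hd q \<in> e \<Longrightarrow> e = {hd q, q ! 1} \<or> e = {hd q, last q}" by (rule *(2))
    qed
    have cyc: "edges_cycle E p" using closed(1)[of p] p by (simp add: l_def)
    have l3: "3 \<le> l" and dist: "distinct p"
      using cyc by (auto simp: edges_cycle_def edges_path_def l_def)
    define nxt where "nxt m = {p ! m, p ! (Suc m mod l)}" for m
    have edge: "\<exists>k<l. e = nxt k" if e: "e \<in> E" "p ! m \<in> e" and m: "m < l" for e m
    proof -
      let ?q = "rotate m p"
      have q: "edges_path E ?q" "set ?q = set p" "length ?q = l"
        using edges_cycle_rotate[OF cyc] by (auto simp: edges_cycle_def l_def)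
      have nth: "?q ! k = p ! ((m + k) mod l)" if "k < l" for k
        using that by (simp add: nth_rotate l_def)
      have hd: "hd ?q = p ! m" using q nth[of 0] l3 m by (simp add: hd_conv_nth ne)
      have last: "last ?q = p ! ((m + l - 1) mod l)"
        using q nth[of "l - 1"] l3 by (simp add: last_conv_nth ne)
      have "Suc ((m + l - 1) mod l) mod l = m" using m l3 by (simp add: mod_Suc_eq)
      then have "{hd ?q, last ?q} = nxt ((m + l - 1) mod l)" using hd last by (auto simp: nxt_def)
      moreover have "{hd ?q, ?q ! 1} = nxt m" using hd nth[of 1] l3 by (simp add: nxt_def)
      moreover have "(m + l - 1) mod l < l" using l3 by simp
      ultimately show ?thesis using closed(2)[OF q, of e] e hd m by metis
    qed
    let ?E = "{e \<in> E. e \<inter> set p = {}}"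
    have "\<exists>out. \<forall>e\<in>?E. \<exists>v\<in>e. out v = e"
    proof (rule less.hyps[of "V - set p"])
      show "finite (V - set p)" using less.prems by simp
      show "e \<subseteq> V - set p \<and> card e = 2" if "e \<in> ?E" for e using E that by blast
      show "card (V - set p) < card V"
        using p(1) ne less.prems(1) by (intro psubset_card_mono) (auto simp: neq_Nil_conv)
      then show "card (V - set p) \<le> N" using less.prems by simp
      show "2 * (N + 1) < 3 * length q" if "edges_cycle ?E q" for q
        using no edges_cycle_mono[OF that, of E] by blast
    qed
    then obtain out where out: "\<forall>e\<in>?E. \<exists>v\<in>e. out v = e" by blast
    define out' where "out' v = (if v \<in> set p then nxt (inv_into {..<l} (nth p) v) else out v)" for v
    have out'_nth: "out' (p ! m) = nxt m" if "m < l" for m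
      using that dist by (auto simp: out'_def l_def inj_on_nth inv_into_f_f)
    have "\<exists>u\<in>e. out' u = e" if eE: "e \<in> E" for e
    proof (cases "e \<inter> set p = {}")
      case True
      then have e: "e \<in> ?E" using that by simp
      obtain u where u: "u \<in> e" "out u = e" using bspec[OF out e] by (rule bexE)
      then have "u \<notin> set p" using True by blast
      then have "out' u = e" using u by (simp add: out'_def)
      then show ?thesis using u(1) by (rule bexI)
    next
      case False
      then obtain m where m: "m < l" "p ! m \<in> e" by (auto simp: in_set_conv_nth l_def)
      obtain k where "k < l" "e = nxt k" using edge[OF eE m(2,1)] by (elim exE conjE)
      then show ?thesis using out'_nth by (intro bexI[of _ "p ! k"]) (auto simp: nxt_def)
    qed
    then show ?thesis by blast
  qed
qed

section \<open>Graphs with lists of admissible constants\<close>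

lemma successively_rtrancl:
  "successively P xs \<Longrightarrow> xs \<noteq> [] \<Longrightarrow> (hd xs, last xs) \<in> {(x, y). P x y}\<^sup>*"
proof (induction xs rule: induct_list012)
  case (3 x y zs)
  then have "(y, last (y # zs)) \<in> {(x, y). P x y}\<^sup>*" by simp
  moreover have "(x, y) \<in> {(x, y). P x y}" using 3 by simp
  ultimately show ?case by (simp add: converse_rtrancl_into_rtrancl)
qed auto

definition mono_rel :: "'a set set \<Rightarrow> ('a \<Rightarrow> 'c set) \<Rightarrow> 'c \<Rightarrow> ('a \<times> 'a) set" where
  "mono_rel E L g = {(u, v). {u, v} \<in> E \<and> g \<in> L u \<and> g \<in> L v}"

lemma sym_mono_rel: "sym (mono_rel E L g)"
  by (auto simp: mono_rel_def sym_def insert_commute)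

locale list_graph =
  fixes V :: "'a set" and E :: "'a set set" and L :: "'a \<Rightarrow> 'c set"
  assumes fin: "finite V"
    and E: "e \<in> E \<Longrightarrow> e \<subseteq> V \<and> card e = 2"
    and cyc: "edges_cycle E p \<Longrightarrow> 3 * length p \<le> 2 * (card V + 1) \<Longrightarrow> \<exists>g. \<forall>v\<in>set p. g \<in> L v"
    and uniq: "u \<in> V \<Longrightarrow> v \<in> V \<Longrightarrow> u \<noteq> v \<Longrightarrow> g \<in> L u \<inter> L v \<Longrightarrow> g' \<in> L u \<inter> L v \<Longrightarrow> g = g'"
begin

lemma cycle_edge_redundant:
  assumes cyc: "edges_cycle H p" and HE: "H \<subseteq> E" and p: "\<And>v. v \<in> set p \<Longrightarrow> g \<in> L v"
  shows "mono_rel H L h \<subseteq> (mono_rel (H - {{last p, hd p}}) L h)\<^sup>*"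
proof
  fix x assume x: "x \<in> mono_rel H L h"
  obtain u v where uv: "x = (u, v)" by (cases x)
  let ?H = "H - {{last p, hd p}}"
  have p3: "distinct p" "3 \<le> length p" and ne: "p \<noteq> []"
    using cyc by (auto simp: edges_cycle_def edges_path_def)
  then have neq: "last p \<noteq> hd p"
    by (simp add: last_conv_nth hd_conv_nth nth_eq_iff_index_eq)
  show "x \<in> (mono_rel ?H L h)\<^sup>*"
  proof (cases "{u, v} = {last p, hd p}")
    case False
    then show ?thesis using x uv by (auto simp: mono_rel_def)
  next
    case True
    have "h \<in> L (last p) \<inter> L (hd p)" using x uv True by (auto simp: mono_rel_def doubleton_eq_iff)
    moreover have "last p \<in> V" "hd p \<in> V"
      using cyc HE E[of "{last p, hd p}"] by (auto simp: edges_cycle_def)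
    ultimately have "h = g" using uniq[of "last p" "hd p"] neq p ne by auto
    have "successively (\<lambda>x y. (x, y) \<in> mono_rel ?H L g) p"
      unfolding successively_conv_nth
    proof (intro allI impI)
      fix i assume i: "Suc i < length p"
      have "{p ! i, p ! Suc i} \<noteq> {last p, hd p}"
        using cyc i ne
        by (auto simp: edges_cycle_def edges_path_def doubleton_eq_iff hd_conv_nth last_conv_nth
            nth_eq_iff_index_eq)
      then show "(p ! i, p ! Suc i) \<in> mono_rel ?H L g"
        using cyc i p by (auto simp: mono_rel_def edges_cycle_def edges_path_def successively_conv_nth)
    qed
    then have *: "(hd p, last p) \<in> (mono_rel ?H L g)\<^sup>*"
      using successively_rtrancl[OF _ ne] by fastforce
    moreover have "(last p, hd p) \<in> (mono_rel ?H L g)\<^sup>*"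
      using * sym_rtrancl[OF sym_mono_rel] by (meson symE)
    ultimately show ?thesis using True uv \<open>h = g\<close> by (auto simp: doubleton_eq_iff)
  qed
qed

lemma ex_skeleton:
  "\<exists>H out. H \<subseteq> E \<and> (\<forall>e\<in>E. \<not> (\<exists>g. \<forall>v\<in>e. g \<in> L v) \<longrightarrow> e \<in> H) \<and>
    (\<forall>g. mono_rel E L g \<subseteq> (mono_rel H L g)\<^sup>*) \<and> (\<forall>e\<in>H. \<exists>v\<in>e. out v = e)"
proof -
  define Q where "Q H \<longleftrightarrow> H \<subseteq> E \<and> (\<forall>e\<in>E. \<not> (\<exists>g. \<forall>v\<in>e. g \<in> L v) \<longrightarrow> e \<in> H) \<and>
    (\<forall>g. mono_rel E L g \<subseteq> (mono_rel H L g)\<^sup>*)" for H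
  have "Q E" by (auto simp: Q_def)
  then obtain H where QH: "Q H" and min: "\<And>H'. Q H' \<Longrightarrow> card H \<le> card H'"
    using ex_has_least_nat[of Q E card] by blast
  then have H: "H \<subseteq> E" "\<forall>e\<in>E. \<not> (\<exists>g. \<forall>v\<in>e. g \<in> L v) \<longrightarrow> e \<in> H"
    "\<forall>g. mono_rel E L g \<subseteq> (mono_rel H L g)\<^sup>*"
    by (simp_all add: Q_def)
  have "finite E" using fin E by (intro finite_subset[of E "Pow V"]) auto
  then have finH: "finite H" using H finite_subset by blast
  have no: "2 * (card V + 1) < 3 * length p" if p: "edges_cycle H p" for p
  proof (rule ccontr)
    assume "\<not> ?thesis"
    then have "3 * length p \<le> 2 * (card V + 1)" by simp
    moreover have "edges_cycle E p" using edges_cycle_mono[OF p] H by blast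
    ultimately obtain g where g: "\<And>v. v \<in> set p \<Longrightarrow> g \<in> L v" using cyc[of p] by blast
    let ?e = "{last p, hd p}" and ?H = "H - {{last p, hd p}}"
    have e: "?e \<in> H" "p \<noteq> []" using p by (auto simp: edges_cycle_def)
    have mono: "\<forall>v\<in>?e. g \<in> L v" using g e by auto
    have "Q ?H"
      unfolding Q_def
    proof (intro conjI allI ballI impI)
      show "?H \<subseteq> E" using H by blast
      show "e \<in> ?H" if "e \<in> E" "\<nexists>g. \<forall>v\<in>e. g \<in> L v" for e using H mono that by blast
      fix h
      have "mono_rel E L h \<subseteq> (mono_rel H L h)\<^sup>*" using H by blast
      also have "\<dots> \<subseteq> (mono_rel ?H L h)\<^sup>*"
        using cycle_edge_redundant[OF p H(1) g] by (rule rtrancl_subset_rtrancl)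
      finally show "mono_rel E L h \<subseteq> (mono_rel ?H L h)\<^sup>*" .
    qed
    then have "card H \<le> card ?H" by (rule min)
    moreover have "card ?H < card H" using finH e by (intro card_Diff1_less) auto
    ultimately show False by simp
  qed
  have "\<exists>out. \<forall>e\<in>H. \<exists>v\<in>e. out v = e"
    by (rule ex_orientation[OF fin _ order.refl no]) (use E H(1) in blast)+
  then obtain out where "\<forall>e\<in>H. \<exists>v\<in>e. out v = e" ..
  then show ?thesis using H by (intro exI[of _ H] exI[of _ out] conjI) simp_all
qed

text \<open>Along a walk starting at a vertex whose out-edge lies outside the relation, all out-edges
  point back towards the start. Hence a component has at most one such vertex.\<close>

lemma component_root_unique:
  assumes out: "\<And>e. e \<in> H \<Longrightarrow> \<exists>v\<in>e. out v = e"
    and xz: "(x, z) \<in> (mono_rel H L g)\<^sup>*"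
    and x: "\<not> (\<exists>y. (y, x) \<in> mono_rel H L g \<and> out x = {y, x})"
  shows "z = x \<or> (\<exists>y. (y, z) \<in> mono_rel H L g \<and> out z = {y, z})"
proof -
  let ?r = "{(y, z) \<in> mono_rel H L g. out z = {y, z}}"
  have "(x, z) \<in> ?r\<^sup>*" using xz
  proof induction
    case base show ?case by simp
  next
    case (step z z')
    have zz': "{z, z'} \<in> H" using step by (simp add: mono_rel_def)
    consider "out z' = {z, z'}" | "out z = {z', z}" using out[OF zz'] by (auto simp: insert_commute)
    then show ?case
    proof cases
      case 1
      then show ?thesis using step by (auto intro: rtrancl_into_rtrancl)
    next
      case 2
      have "(z', z) \<in> mono_rel H L g" using step sym_mono_rel by (meson symE)
      then have "z \<noteq> x" using 2 x by blast
      then obtain y where y: "(x, y) \<in> ?r\<^sup>*" "(y, z) \<in> ?r"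
        using step.IH by (metis (no_types, lifting) rtranclE)
      then have "y = z'" using 2 by (auto simp: doubleton_eq_iff)
      then show ?thesis using y by simp
    qed
  qed
  then show ?thesis by (rule rtranclE) auto
qed

lemma ex_monochromatic_decomposition:
  "\<exists>col ex. (\<forall>v g. col v = Some g \<longrightarrow> g \<in> L v) \<and>
    (\<forall>e\<in>E. (\<exists>g. \<forall>v\<in>e. col v = Some g) \<or> (\<exists>v\<in>e. ex v = e))"
proof -
  obtain H out where H: "H \<subseteq> E" "\<forall>e\<in>E. \<not> (\<exists>g. \<forall>v\<in>e. g \<in> L v) \<longrightarrow> e \<in> H"
      "\<forall>g. mono_rel E L g \<subseteq> (mono_rel H L g)\<^sup>*" and out': "\<forall>e\<in>H. \<exists>v\<in>e. out v = e"
    using ex_skeleton by (elim exE conjE)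
  have out: "\<exists>v\<in>e. out v = e" if "e \<in> H" for e using out' that by (rule bspec)
  define own where "own g z \<longleftrightarrow> (\<exists>y. (y, z) \<in> mono_rel H L g \<and> out z = {y, z})" for g z
  have own_L: "g \<in> L z" if "own g z" for g z
    using that by (auto simp: own_def mono_rel_def)
  have own_unique: "g = h" if gh: "own g z" "own h z" for g h z
  proof -
    obtain y y' where y: "(y, z) \<in> mono_rel H L g" "(y', z) \<in> mono_rel H L h" "{y, z} = {y', z}"
      using gh by (auto simp: own_def)
    then have "y' = y" by (auto simp: doubleton_eq_iff)
    then have "(y, z) \<in> mono_rel H L h" using y(2) by simp
    with y(1) have L: "g \<in> L y \<inter> L z" "h \<in> L y \<inter> L z" and "{y, z} \<in> H"
      by (simp_all add: mono_rel_def)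
    then have "{y, z} \<in> E" using H(1) by blast
    then have *: "{y, z} \<subseteq> V \<and> card {y, z} = 2" by (rule E)
    then have "y \<noteq> z" by (cases "y = z") simp_all
    moreover have "y \<in> V" "z \<in> V" using * by simp_all
    ultimately show ?thesis using L uniq by meson
  qed
  define col where "col z = (if \<exists>g. own g z then Some (THE g. own g z) else None)" for z
  have col: "col z = Some g \<longleftrightarrow> own g z" for z g
  proof
    assume g: "own g z"
    then have "(THE g. own g z) = g" by (rule the_equality) (rule own_unique[OF _ g])
    then show "col z = Some g" using g by (auto simp: col_def)
  next
    assume "col z = Some g"
    then obtain h where h: "own h z" and g: "g = (THE g. own g z)"
      by (auto simp: col_def split: if_splits)
    have "(THE g. own g z) = h" using h by (rule the_equality) (rule own_unique[OF _ h])
    then show "own g z" using g h by simp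
  qed
  define ex where "ex z = (case col z of Some g \<Rightarrow>
    {z, SOME x. \<not> own g x \<and> (x, z) \<in> (mono_rel H L g)\<^sup>*} | None \<Rightarrow> out z)" for z
  show ?thesis
  proof (intro exI conjI allI ballI impI)
    show "g \<in> L v" if "col v = Some g" for v g using that own_L col by blast
    fix e assume e: "e \<in> E"
    show "(\<exists>g. \<forall>v\<in>e. col v = Some g) \<or> (\<exists>v\<in>e. ex v = e)"
    proof (cases "\<exists>g. \<forall>v\<in>e. g \<in> L v")
      case True
      then obtain g where g: "\<forall>v\<in>e. g \<in> L v" ..
      show ?thesis
      proof (cases "\<forall>v\<in>e. own g v")
        case True
        then show ?thesis using col by blast
      next
        case False
        then obtain u where u: "u \<in> e" "\<not> own g u" by blast
        obtain v where v: "e = {u, v}" "v \<noteq> u" using card2_other E e u by metis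
        have uv: "(u, v) \<in> (mono_rel H L g)\<^sup>*"
          using spec[OF H(3), of g] g e v by (auto simp: mono_rel_def)
        then have "own g v"
          using component_root_unique[OF out uv] u v by (auto simp: own_def)
        moreover have "(SOME x. \<not> own g x \<and> (x, v) \<in> (mono_rel H L g)\<^sup>*) = u"
        proof (rule some_equality)
          show "\<not> own g u \<and> (u, v) \<in> (mono_rel H L g)\<^sup>*" using u uv by blast
          fix x assume x: "\<not> own g x \<and> (x, v) \<in> (mono_rel H L g)\<^sup>*"
          have "(v, u) \<in> (mono_rel H L g)\<^sup>*"
            using uv sym_rtrancl[OF sym_mono_rel] by (meson symE)
          then have xu: "(x, u) \<in> (mono_rel H L g)\<^sup>*" using x rtrancl_trans by metis
          show "x = u" using component_root_unique[OF out xu] x u by (auto simp: own_def)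
        qed
        ultimately have "ex v = e" using v col[of v g] by (auto simp: ex_def)
        then show ?thesis using v by blast
      qed
    next
      case False
      then have "e \<in> H" using H e by blast
      then obtain v where v: "v \<in> e" "out v = e" using out[OF \<open>e \<in> H\<close>] by (elim bexE)
      have "\<not> own g v" for g
        using False v by (auto simp: own_def mono_rel_def)
      then have "ex v = e" using v by (simp add: ex_def col_def)
      then show ?thesis using v by blast
    qed
  qed
qed

end

section \<open>The adjacency operator and the mixing bound\<close>

lemma quadratic_nonneg_linear_zero:
  fixes a b :: real
  assumes "\<And>x. 0 \<le> x * a + x\<^sup>2 * b"
  shows "a = 0"
proof (rule ccontr)
  assume "a \<noteq> 0"
  define c where "c = \<bar>b\<bar> + 1"
  have c: "0 < c" "b < c" by (auto simp: c_def)
  have "0 \<le> (- a / c) * a + (- a / c)\<^sup>2 * b" by (rule assms)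
  also have "\<dots> = a\<^sup>2 * (b - c) / c\<^sup>2" using c by (simp add: field_simps power2_eq_square)
  also have "\<dots> < 0" using c \<open>a \<noteq> 0\<close> by (intro divide_neg_pos mult_pos_neg) auto
  finally show False by simp
qed

locale wgraph =
  fixes X :: "'a set set" and w :: "'a set \<Rightarrow> real"
  assumes wg: "weighted_graph X w"
begin

definition V :: "'a set" where "V = \<Union>X"

definition Es :: "'a set set" where "Es = faces X 1"

definition W :: "'a \<Rightarrow> real" where "W v = w {v}"

lemma finite_X: "finite X"
  using wg by (simp add: weighted_graph_def graph_def)

lemma finite_V: "finite V"
  using wg by (auto simp: V_def weighted_graph_def graph_def)

lemma finite_Es: "finite Es"
  using finite_X by (simp add: Es_def faces_def)

lemma subface: "x \<in> X \<Longrightarrow> y \<subseteq> x \<Longrightarrow> y \<in> X"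
  using wg by (simp add: weighted_graph_def graph_def)

lemma singleton_in_X: "v \<in> V \<Longrightarrow> {v} \<in> X"
  using subface by (auto simp: V_def)

lemma edge: "e \<in> Es \<Longrightarrow> e \<subseteq> V \<and> card e = 2"
  by (auto simp: Es_def faces_def V_def)

lemma edge_in_X: "e \<in> Es \<Longrightarrow> e \<in> X"
  by (simp add: Es_def faces_def)

lemma vertex_faces: "faces X 0 = (\<lambda>v. {v}) ` V"
  using singleton_in_X by (auto simp: faces_def V_def card_1_singleton_iff)

lemma sum_vertex_faces: "(\<Sum>x\<in>faces X 0. F x) = (\<Sum>v\<in>V. F {v})"
  unfolding vertex_faces by (subst sum.reindex) auto

lemma w_nonneg: "e \<in> Es \<Longrightarrow> 0 \<le> w e"
  using wg by (simp add: weighted_graph_def Es_def faces_def)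

lemma sum_w: "(\<Sum>e\<in>Es. w e) = 1"
  using wg by (simp add: weighted_graph_def Es_def)

lemma W_pos: "v \<in> V \<Longrightarrow> 0 < W v"
  using wg by (auto simp: weighted_graph_def vertex_faces W_def)

lemma W_eq: "v \<in> V \<Longrightarrow> W v = (\<Sum>e | e \<in> Es \<and> v \<in> e. w e / 2)"
  using wg by (auto simp: weighted_graph_def vertex_faces W_def Es_def simp flip: sum_divide_distrib)

lemma sum_swap_edges:
  "(\<Sum>v\<in>V. \<Sum>e | e \<in> Es \<and> v \<in> e. F v e) = (\<Sum>e\<in>Es. \<Sum>v\<in>e. F v e)"
proof -
  have "{v. v \<in> V \<and> v \<in> e} = e" if "e \<in> Es" for e using edge[OF that] by auto
  then show ?thesis
    unfolding sum.swap_restrict[OF finite_V finite_Es] by (intro sum.cong) simp_all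
qed

lemma sum_W: "(\<Sum>v\<in>V. W v) = 1"
proof -
  have "(\<Sum>v\<in>V. W v) = (\<Sum>v\<in>V. \<Sum>e | e \<in> Es \<and> v \<in> e. w e / 2)"
    by (rule sum.cong) (simp_all add: W_eq)
  also have "\<dots> = (\<Sum>e\<in>Es. w e)"
    unfolding sum_swap_edges using edge by (intro sum.cong) simp_all
  finally show ?thesis by (simp add: sum_w)
qed

definition adj :: "('a \<Rightarrow> real) \<Rightarrow> 'a \<Rightarrow> real" where
  "adj h v = (\<Sum>e | e \<in> Es \<and> v \<in> e. w e / (2 * W v) * h (the_elem (e - {v})))"

definition ip :: "('a \<Rightarrow> real) \<Rightarrow> ('a \<Rightarrow> real) \<Rightarrow> real" where
  "ip h k = (\<Sum>v\<in>V. W v * h v * k v)"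

definition adj_form :: "('a \<Rightarrow> real) \<Rightarrow> ('a \<Rightarrow> real) \<Rightarrow> real" where
  "adj_form h k = (\<Sum>e\<in>Es. w e / 2 * (\<Sum>v\<in>e. h v * k (the_elem (e - {v}))))"

lemma edge_sum:
  assumes "a \<noteq> b"
  shows "(\<Sum>v\<in>{a, b}. F v (the_elem ({a, b} - {v}))) = F a b + F b a"
proof -
  have "{a, b} - {a} = {b}" "{a, b} - {b} = {a}" using assms by auto
  then show ?thesis using assms by simp
qed

lemma adj_form_commute: "adj_form h k = adj_form k h"
  unfolding adj_form_def
proof (rule sum.cong[OF refl])
  fix e assume "e \<in> Es"
  then obtain a b where e: "e = {a, b}" "a \<noteq> b" using edge by (metis card_2_iff)
  show "w e / 2 * (\<Sum>v\<in>e. h v * k (the_elem (e - {v}))) =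
    w e / 2 * (\<Sum>v\<in>e. k v * h (the_elem (e - {v})))"
    unfolding e(1) using edge_sum[OF e(2), of "\<lambda>x y. h x * k y"] edge_sum[OF e(2), of "\<lambda>x y. k x * h y"]
    by simp
qed

lemma adj_form_add_left: "adj_form (\<lambda>v. h v + c * k v) m = adj_form h m + c * adj_form k m"
  by (simp add: adj_form_def algebra_simps sum.distrib sum_distrib_left add_divide_distrib)

lemma adj_form_add_right: "adj_form m (\<lambda>v. h v + c * k v) = adj_form m h + c * adj_form m k"
  by (metis adj_form_add_left adj_form_commute)

lemma ip_commute: "ip h k = ip k h"
  by (simp add: ip_def mult_ac)

lemma ip_add_left: "ip (\<lambda>v. h v + c * k v) m = ip h m + c * ip k m"
  by (simp add: ip_def algebra_simps sum.distrib sum_distrib_left)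

lemma ip_add_right: "ip m (\<lambda>v. h v + c * k v) = ip m h + c * ip m k"
  by (simp add: ip_def algebra_simps sum.distrib sum_distrib_left)

lemma adj_form_eq_ip: "adj_form h k = ip h (adj k)"
proof -
  have "ip h (adj k) = (\<Sum>v\<in>V. \<Sum>e | e \<in> Es \<and> v \<in> e. w e / 2 * (h v * k (the_elem (e - {v}))))"
    unfolding ip_def adj_def
  proof (rule sum.cong[OF refl])
    fix v assume "v \<in> V"
    then have "W v \<noteq> 0" using W_pos by force
    then show "W v * h v * (\<Sum>e | e \<in> Es \<and> v \<in> e. w e / (2 * W v) * k (the_elem (e - {v}))) =
      (\<Sum>e | e \<in> Es \<and> v \<in> e. w e / 2 * (h v * k (the_elem (e - {v}))))"
      by (simp add: sum_distrib_left field_simps)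
  qed
  also have "\<dots> = adj_form h k"
    unfolding sum_swap_edges adj_form_def by (simp add: sum_distrib_left)
  finally show ?thesis by simp
qed

lemma adj_form_one: "adj_form h (\<lambda>_. 1) = ip h (\<lambda>_. 1)"
proof -
  have "adj (\<lambda>_. 1) v = 1" if "v \<in> V" for v
  proof -
    have "adj (\<lambda>_. 1) v = (\<Sum>e | e \<in> Es \<and> v \<in> e. w e / 2) / W v"
      by (simp add: adj_def sum_divide_distrib)
    then show ?thesis using W_eq[OF that] W_pos[OF that] by simp
  qed
  then show ?thesis unfolding adj_form_eq_ip ip_def by simp
qed

lemma ip_term_nonneg: "v \<in> V \<Longrightarrow> 0 \<le> W v * h v * h v"
  using W_pos[of v] by (simp add: mult.assoc)

lemma ip_self_nonneg: "0 \<le> ip h h"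
  unfolding ip_def by (intro sum_nonneg ip_term_nonneg)

lemma ip_self_eq_0:
  assumes "ip h h = 0" "v \<in> V" shows "h v = 0"
proof -
  have "W v * h v * h v = 0"
    using assms sum_nonneg_eq_0_iff[OF finite_V ip_term_nonneg[of _ h]] by (simp add: ip_def)
  then show ?thesis using W_pos[OF assms(2)] by simp
qed

lemma adj_form_eq_0: "(\<And>v. v \<in> V \<Longrightarrow> h v = 0) \<Longrightarrow> adj_form h k = 0"
  by (simp add: adj_form_eq_ip ip_def)

lemma adj_form_scale: "adj_form (\<lambda>v. c * h v) (\<lambda>v. c * h v) = c\<^sup>2 * adj_form h h"
  by (simp add: adj_form_def sum_distrib_left power2_eq_square mult_ac)

lemma ip_scale: "ip (\<lambda>v. c * h v) (\<lambda>v. c * h v) = c\<^sup>2 * ip h h"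
  by (simp add: ip_def sum_distrib_left power2_eq_square mult_ac)

lemma ex_rayleigh_maximiser:
  assumes h: "ip h (\<lambda>_. 1) = 0" "ip h h \<noteq> 0"
  shows "\<exists>f. ip f (\<lambda>_. 1) = 0 \<and> ip f f = 1 \<and>
    (\<forall>k. ip k (\<lambda>_. 1) = 0 \<longrightarrow> adj_form k k \<le> adj_form f f * ip k k)"
proof -
  define K where "K = {h. (\<forall>v. v \<notin> V \<longrightarrow> h v = 0) \<and> ip h (\<lambda>_. 1) = 0 \<and> ip h h = 1}"
  define box where "box v = (if v \<in> V then {- (1 + 1 / W v) .. 1 + 1 / W v} else {0})" for v
  have cont: "continuous_on UNIV (\<lambda>h::'a \<Rightarrow> real. h v)" for v
    by (rule continuous_on_product_coordinates)
  have "compactin (product_topology (\<lambda>_. euclidean) UNIV) (PiE UNIV box)"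
    unfolding compactin_PiE by (auto simp: box_def)
  then have compact_box: "compact (PiE UNIV box)"
    by (simp add: euclidean_product_topology)
  have cont_ip: "continuous_on UNIV (\<lambda>h. ip h (\<lambda>_. 1))" "continuous_on UNIV (\<lambda>h. ip h h)"
    unfolding ip_def by (intro continuous_intros cont)+
  have cont_form: "continuous_on UNIV (\<lambda>h. adj_form h h)"
    unfolding adj_form_def by (intro continuous_intros cont)
  have "K = (\<Inter>v\<in>-V. {h. h v = 0}) \<inter> {h. ip h (\<lambda>_. 1) = 0} \<inter> {h. ip h h = 1}"
    by (auto simp: K_def)
  also have "closed \<dots>"
    by (intro closed_Int closed_INT ballI closed_Collect_eq cont cont_ip continuous_on_const)
  finally have "closed K" .
  have "K \<subseteq> PiE UNIV box"
  proof
    fix k assume k: "k \<in> K"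
    have "k v \<in> box v" for v
    proof (cases "v \<in> V")
      case True
      have "W v * k v * k v \<le> ip k k"
        unfolding ip_def using True finite_V by (intro member_le_sum ip_term_nonneg) auto
      then have "(k v)\<^sup>2 \<le> 1 / W v"
        using k W_pos[OF True] by (simp add: K_def field_simps power2_eq_square)
      moreover define q where "q = 1 / W v"
      have "0 < q" using W_pos[OF True] by (simp add: q_def)
      then have "q \<le> (1 + q)\<^sup>2" by (simp add: power2_eq_square algebra_simps)
      ultimately have "\<bar>k v\<bar>\<^sup>2 \<le> (1 + q)\<^sup>2" unfolding q_def[symmetric] power2_abs by (rule order_trans)
      then have "\<bar>k v\<bar> \<le> 1 + q" by (rule power2_le_imp_le) (use \<open>0 < q\<close> in simp)
      then have "k v \<in> {- (1 + q)..1 + q}" by (simp add: abs_le_iff)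
      then show ?thesis using True by (simp add: box_def q_def)
    qed (use k in \<open>auto simp: box_def K_def\<close>)
    then show "k \<in> PiE UNIV box" by auto
  qed
  then have "compact K"
    using compact_box \<open>closed K\<close> by (metis compact_Int_closed inf.absorb_iff2)
  have normalise: "\<exists>c k'. k' \<in> K \<and> c > 0 \<and> adj_form k' k' = c * adj_form k k \<and> c * ip k k = 1"
    if k: "ip k (\<lambda>_. 1) = 0" "ip k k \<noteq> 0" for k
  proof -
    have pos: "ip k k > 0" using ip_self_nonneg[of k] k by simp
    define c where "c = 1 / sqrt (ip k k)"
    have c2: "c\<^sup>2 = 1 / ip k k" using pos by (simp add: c_def power_divide)
    define k' where "k' v = (if v \<in> V then c * k v else 0)" for v
    have V': "ip k' m = ip (\<lambda>v. c * k v) m" for m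
      by (auto simp: ip_def k'_def intro!: sum.cong)
    have V'': "ip m k' = ip m (\<lambda>v. c * k v)" for m
      using V' ip_commute by metis
    have form: "adj_form k' k' = adj_form (\<lambda>v. c * k v) (\<lambda>v. c * k v)"
      by (metis V' adj_form_commute adj_form_eq_ip)
    have "ip k' (\<lambda>_. 1) = c * ip k (\<lambda>_. 1)"
      unfolding V' by (simp add: ip_def sum_distrib_left mult_ac)
    moreover have "ip k' k' = 1" unfolding V' V'' ip_scale c2 using pos by simp
    ultimately have "k' \<in> K" using k by (simp add: K_def k'_def)
    then show ?thesis
      using pos c2 by (intro exI[of _ "c\<^sup>2"] exI[of _ k']) (simp add: form adj_form_scale)
  qed
  have "K \<noteq> {}" using normalise[OF h] by blast
  then obtain f where f: "f \<in> K" "\<And>k. k \<in> K \<Longrightarrow> adj_form k k \<le> adj_form f f"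
    using continuous_attains_sup[OF \<open>compact K\<close>, of "\<lambda>h. adj_form h h"] cont_form
    by (meson continuous_on_subset subset_UNIV)
  have "adj_form k k \<le> adj_form f f * ip k k" if k: "ip k (\<lambda>_. 1) = 0" for k
  proof (cases "ip k k = 0")
    case True
    then show ?thesis using adj_form_eq_0 ip_self_eq_0 by simp
  next
    case False
    obtain c k' where c: "k' \<in> K" "c > 0" "adj_form k' k' = c * adj_form k k" "c * ip k k = 1"
      using normalise[OF k False] by blast
    have "c * adj_form k k \<le> adj_form f f * (c * ip k k)" using f(2)[OF c(1)] c by simp
    then show ?thesis using c(2) by (simp add: mult.left_commute)
  qed
  then show ?thesis using f(1) by (auto simp: K_def)
qed

lemma rayleigh_le:
  assumes sp: "spectral_expander X w \<mu> \<kappa>" and h: "ip h (\<lambda>_. 1) = 0"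
  shows "adj_form h h \<le> \<kappa> * ip h h"
proof (cases "ip h h = 0")
  case True
  then show ?thesis using adj_form_eq_0 ip_self_eq_0 by simp
next
  case False
  obtain f where f: "ip f (\<lambda>_. 1) = 0" "ip f f = 1"
      "\<And>k. ip k (\<lambda>_. 1) = 0 \<Longrightarrow> adj_form k k \<le> adj_form f f * ip k k"
    using ex_rayleigh_maximiser[OF h False] by blast
  define m where "m = adj_form f f"
  define k where "k v = adj f v + (- m) * f v" for v
  have k_eq: "k = (\<lambda>v. adj f v + (- m) * f v)" by (simp add: fun_eq_iff k_def)
  have "ip (\<lambda>_. 1) (adj f) = 0"
    using adj_form_one[of f] f(1) by (simp add: adj_form_eq_ip[symmetric] adj_form_commute[of _ f])
  then have k0: "ip k (\<lambda>_. 1) = 0"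
    unfolding k_eq ip_add_left using f(1) by (simp add: ip_commute)
  have "2 * (m * ip f k - adj_form k f) = 0"
  proof (rule quadratic_nonneg_linear_zero)
    fix x
    let ?g = "\<lambda>v. f v + x * k v"
    have "ip ?g (\<lambda>_. 1) = 0" unfolding ip_add_left using f(1) k0 by simp
    then have "adj_form ?g ?g \<le> m * ip ?g ?g" using f(3) by (simp add: m_def)
    then show "0 \<le> x * (2 * (m * ip f k - adj_form k f)) + x\<^sup>2 * (m * ip k k - adj_form k k)"
      unfolding adj_form_add_left adj_form_add_right ip_add_left ip_add_right
      using f(2) ip_commute[of k f] adj_form_commute[of f k]
      by (simp add: m_def algebra_simps power2_eq_square)
  qed
  then have "ip k (adj f) + (- m) * ip k f = 0" by (simp add: adj_form_eq_ip ip_commute)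
  then have "ip k k = 0" unfolding ip_add_right[symmetric] k_eq[symmetric] .
  then have eig: "adj f v = m * f v" if "v \<in> V" for v
    using ip_self_eq_0[of k v] that by (simp add: k_def)
  have "eigenvalue_mean0 X w m"
    unfolding eigenvalue_mean0_def
  proof (intro exI conjI ballI)
    let ?F = "\<lambda>x. f (the_elem x)"
    show "(\<Sum>v\<in>faces X 0. w v * ?F v) = 0"
      using f(1) by (simp add: sum_vertex_faces ip_def W_def)
    have "\<exists>v\<in>V. f v \<noteq> 0" using f(2) by (auto simp: ip_def intro: ccontr)
    then show "\<exists>v\<in>faces X 0. ?F v \<noteq> 0" by (simp add: vertex_faces)
    fix x assume "x \<in> faces X 0"
    then obtain v where v: "v \<in> V" "x = {v}" by (auto simp: vertex_faces)
    have "adjacency_op X w ?F x = adj f v" by (simp add: adjacency_op_def adj_def v W_def Es_def)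
    then show "adjacency_op X w ?F x = m * ?F x" using eig v by simp
  qed
  then have "m \<le> \<kappa>" using sp by (auto simp: spectral_expander_def)
  then have "m * ip h h \<le> \<kappa> * ip h h" using ip_self_nonneg by (rule mult_right_mono)
  then show ?thesis using f(3)[OF h] by (simp add: m_def)
qed

definition Wt :: "'a set \<Rightarrow> real" where "Wt A = (\<Sum>v\<in>A. W v)"

definition inner_weight :: "'a set \<Rightarrow> real" where
  "inner_weight A = (\<Sum>e | e \<in> Es \<and> e \<subseteq> A. w e)"

lemma adj_form_indicator: "adj_form (indicator A) (indicator A) = inner_weight A"
proof -
  have "w e / 2 * (\<Sum>v\<in>e. indicator A v * indicator A (the_elem (e - {v}))) =
    (if e \<subseteq> A then w e else 0)" if "e \<in> Es" for e
  proof -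
    have "card e = 2" using edge[OF that] ..
    then obtain a b where e: "e = {a, b}" "a \<noteq> b" unfolding card_2_iff by (elim exE conjE)
    show ?thesis
      unfolding e(1) edge_sum[OF e(2), of "\<lambda>x y. indicator A x * indicator A y"]
      by (cases "a \<in> A"; cases "b \<in> A") simp_all
  qed
  then show ?thesis
    unfolding adj_form_def inner_weight_def sum.inter_filter[OF finite_Es] by (rule sum.cong[OF refl])
qed

lemma ip_indicator: "A \<subseteq> V \<Longrightarrow> ip (indicator A) k = (\<Sum>v\<in>A. W v * k v)"
  unfolding ip_def using finite_V
  by (intro sum.mono_neutral_cong_right) (auto simp: indicator_def)

lemma mixing:
  assumes sp: "spectral_expander X w \<mu> \<kappa>" and A: "A \<subseteq> V"
  shows "inner_weight A \<le> \<kappa> * Wt A + (1 - \<kappa>) * (Wt A)\<^sup>2"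
proof -
  let ?I = "indicator A :: 'a \<Rightarrow> real" and ?o = "\<lambda>_. 1 :: real"
  let ?h = "\<lambda>v. ?I v + (- Wt A) * ?o v"
  have I1: "ip ?I ?o = Wt A" using ip_indicator[OF A] by (simp add: Wt_def)
  have II: "ip ?I ?I = Wt A" using ip_indicator[OF A, of ?I] by (simp add: Wt_def)
  have 11: "ip ?o ?o = 1" using sum_W by (simp add: ip_def)
  have F1: "adj_form ?I ?o = Wt A" "adj_form ?o ?o = 1" using adj_form_one I1 11 by simp_all
  have "ip ?h ?o = 0" unfolding ip_add_left using I1 11 by simp
  then have "adj_form ?h ?h \<le> \<kappa> * ip ?h ?h" by (rule rayleigh_le[OF sp])
  then show ?thesis
    unfolding adj_form_add_left adj_form_add_right ip_add_left ip_add_right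
    using I1 II 11 F1 ip_commute[of ?o ?I] adj_form_commute[of ?o ?I]
    by (simp add: adj_form_indicator algebra_simps power2_eq_square)
qed

end

section \<open>Locating an almost constant cochain\<close>

context wgraph
begin

lemma Wt_mono: "A \<subseteq> B \<Longrightarrow> B \<subseteq> V \<Longrightarrow> Wt A \<le> Wt B"
  unfolding Wt_def using finite_V W_pos
  by (intro sum_mono2) (auto intro: finite_subset less_imp_le)

lemma Wt_nonneg: "A \<subseteq> V \<Longrightarrow> 0 \<le> Wt A"
  using Wt_mono[of "{}" A] by (simp add: Wt_def)

lemma Wt_V: "Wt V = 1"
  by (simp add: Wt_def sum_W)

lemma Wt_le_1: "A \<subseteq> V \<Longrightarrow> Wt A \<le> 1"
  using Wt_mono[of A V] Wt_V by simp

lemma Wt_compl: "A \<subseteq> V \<Longrightarrow> Wt (V - A) = 1 - Wt A"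
  using sum_diff[OF finite_V, of A W] Wt_V by (simp add: Wt_def)

lemma mixing_weaken:
  assumes sp: "spectral_expander X w \<mu> \<kappa>" and A: "A \<subseteq> V" and l: "\<kappa> \<le> l"
  shows "inner_weight A \<le> l * Wt A + (1 - l) * (Wt A)\<^sup>2"
proof -
  have "(Wt A)\<^sup>2 \<le> Wt A"
    using Wt_nonneg[OF A] Wt_le_1[OF A] by (simp add: power2_eq_square mult_left_le)
  then have "0 \<le> (l - \<kappa>) * (Wt A - (Wt A)\<^sup>2)" using l by simp
  then show ?thesis using mixing[OF sp A] by (simp add: algebra_simps)
qed

lemma boundary_weight_ge:
  assumes A: "A \<subseteq> V"
  shows "2 * (Wt A - inner_weight A) \<le> (\<Sum>e | e \<in> Es \<and> \<not> e \<subseteq> A \<and> e \<inter> A \<noteq> {}. w e)"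
proof -
  have finA: "finite A" using A finite_V finite_subset by blast
  have "Wt A = (\<Sum>v\<in>A. \<Sum>e | e \<in> Es \<and> v \<in> e. w e / 2)"
    unfolding Wt_def using A by (intro sum.cong) (auto simp: W_eq)
  also have "\<dots> = (\<Sum>e\<in>Es. \<Sum>v | v \<in> A \<and> v \<in> e. w e / 2)"
    by (rule sum.swap_restrict[OF finA finite_Es])
  also have "\<dots> \<le> (\<Sum>e\<in>Es. (if e \<subseteq> A then w e else 0) +
      (if \<not> e \<subseteq> A \<and> e \<inter> A \<noteq> {} then w e else 0) / 2)"
  proof (rule sum_mono)
    fix e assume e: "e \<in> Es"
    have card: "card e = 2" and fin: "finite e"
      using edge[OF e] by (auto intro: card_ge_0_finite)
    have *: "(\<Sum>v | v \<in> A \<and> v \<in> e. w e / 2) = real (card (e \<inter> A)) * (w e / 2)"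
      by (simp add: Int_def conj_commute)
    consider "e \<subseteq> A" | "e \<inter> A = {}" "\<not> e \<subseteq> A" | "e \<inter> A \<subset> e" "e \<inter> A \<noteq> {}" "\<not> e \<subseteq> A" by blast
    then show "(\<Sum>v | v \<in> A \<and> v \<in> e. w e / 2) \<le> (if e \<subseteq> A then w e else 0) +
      (if \<not> e \<subseteq> A \<and> e \<inter> A \<noteq> {} then w e else 0) / 2"
    proof cases
      case 1
      then have "e \<inter> A = e" by blast
      then show ?thesis unfolding * using 1 card by simp
    next
      case 2
      then show ?thesis unfolding * by simp
    next
      case 3
      have "card (e \<inter> A) < 2" using psubset_card_mono[OF fin 3(1)] card by simp
      then have "real (card (e \<inter> A)) * (w e / 2) \<le> 1 * (w e / 2)"
        using w_nonneg[OF e] by (intro mult_right_mono) auto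
      then show ?thesis unfolding * using 3 by simp
    qed
  qed
  also have "\<dots> = inner_weight A + (\<Sum>e | e \<in> Es \<and> \<not> e \<subseteq> A \<and> e \<inter> A \<noteq> {}. w e) / 2"
    unfolding sum.distrib inner_weight_def sum.inter_filter[OF finite_Es] sum_divide_distrib ..
  finally show ?thesis by simp
qed

end

locale wgraph_lists = wgraph X w + list_graph V Good L
  for X :: "'a set set" and w Good and L :: "'a \<Rightarrow> 'c set" +
  fixes C :: "'c set" and t \<mu> \<kappa> l :: real
  assumes Good: "Good \<subseteq> Es"
    and path: "{u, v} \<in> Good \<Longrightarrow> {v, u'} \<in> Good \<Longrightarrow> u \<noteq> u' \<Longrightarrow> g \<in> L u \<Longrightarrow> g \<in> L u' \<Longrightarrow> g \<in> L v"
    and t: "0 \<le> t" "e \<in> Es \<Longrightarrow> v \<in> e \<Longrightarrow> w e \<le> t * W v"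
    and C: "C \<noteq> {}" "v \<in> V \<Longrightarrow> L v \<subseteq> C"
    and sp: "spectral_expander X w \<mu> \<kappa>"
    and l: "\<kappa> \<le> l" "0 \<le> l" "l \<le> 1"
begin

definition agree :: "'c \<Rightarrow> 'a set" where "agree g = {v \<in> V. g \<in> L v}"

lemma agree_subset: "agree g \<subseteq> V"
  by (auto simp: agree_def)

lemma good_weight_le:
  assumes m: "\<And>g. g \<in> C \<Longrightarrow> Wt (agree g) \<le> m"
  shows "(\<Sum>e\<in>Good. w e) \<le> t + l + (1 - l) * m"
proof -
  obtain col ex where col: "\<forall>v g. col v = Some g \<longrightarrow> g \<in> L v"
    and ex: "\<forall>e\<in>Good. (\<exists>g. \<forall>v\<in>e. col v = Some g) \<or> (\<exists>v\<in>e. ex v = e)"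
    using ex_monochromatic_decomposition by (elim exE conjE)
  define T where "T g = {v \<in> V. col v = Some g}" for g
  define \<Gamma> where "\<Gamma> = {g. Some g \<in> col ` V}"
  define inner where "inner g = {e \<in> Es. e \<subseteq> T g}" for g
  define Ex where "Ex = {e \<in> Es. \<exists>v\<in>e. ex v = e}"
  have finG: "finite \<Gamma>"
  proof -
    have "\<Gamma> = Some -` (col ` V)" by (auto simp: \<Gamma>_def)
    then show ?thesis using finite_V by (simp add: finite_vimageI)
  qed
  have T_sub: "T g \<subseteq> V" "T g \<subseteq> agree g" for g using col by (auto simp: T_def agree_def)
  have finT: "finite (T g)" for g using finite_V by (simp add: T_def)
  have T_disj: "T g \<inter> T h = {}" if "g \<noteq> h" for g h using that by (auto simp: T_def)
  have nonempty: "e \<noteq> {}" if "e \<in> Es" for e using edge[OF that] by auto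
  have inner_disj: "inner g \<inter> inner h = {}" if "g \<noteq> h" for g h
    using T_disj[OF that] nonempty by (fastforce simp: inner_def)
  have fin: "finite (inner g)" "finite Ex" for g using finite_Es by (simp_all add: inner_def Ex_def)
  have "Good \<subseteq> (\<Union>g\<in>\<Gamma>. inner g) \<union> Ex"
  proof
    fix e assume e: "e \<in> Good"
    then have eE: "e \<in> Es" using Good by blast
    from bspec[OF ex e] show "e \<in> (\<Union>g\<in>\<Gamma>. inner g) \<union> Ex"
    proof
      assume "\<exists>g. \<forall>v\<in>e. col v = Some g"
      then obtain g where g: "\<forall>v\<in>e. col v = Some g" ..
      obtain v where v: "v \<in> e" using nonempty[OF eE] by blast
      have "e \<subseteq> V" using edge[OF eE] ..
      have "col v = Some g" using g v ..
      then have "g \<in> \<Gamma>" using v \<open>e \<subseteq> V\<close> by (auto simp: \<Gamma>_def image_iff intro: sym)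
      moreover have "e \<in> inner g" using g eE \<open>e \<subseteq> V\<close> by (auto simp: inner_def T_def)
      ultimately show ?thesis by blast
    next
      assume "\<exists>v\<in>e. ex v = e"
      then show ?thesis using eE by (simp add: Ex_def)
    qed
  qed
  then have "(\<Sum>e\<in>Good. w e) \<le> (\<Sum>e\<in>(\<Union>g\<in>\<Gamma>. inner g) \<union> Ex. w e)"
    using fin finG by (intro sum_mono2) (auto simp: inner_def Ex_def intro: w_nonneg)
  also have "\<dots> \<le> (\<Sum>e\<in>(\<Union>g\<in>\<Gamma>. inner g). w e) + (\<Sum>e\<in>Ex. w e)"
  proof -
    have "0 \<le> (\<Sum>e\<in>(\<Union>g\<in>\<Gamma>. inner g) \<inter> Ex. w e)"
      by (rule sum_nonneg) (auto simp: Ex_def intro: w_nonneg)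
    then show ?thesis using sum_Un[of "\<Union>g\<in>\<Gamma>. inner g" Ex w] fin finG by simp
  qed
  also have "(\<Sum>e\<in>Ex. w e) \<le> (\<Sum>v\<in>V. t * W v)"
  proof (rule sum_le_included[where i = ex])
    show "\<forall>v\<in>V. 0 \<le> t * W v" using t(1) W_pos by (simp add: less_imp_le)
    show "\<forall>e\<in>Ex. \<exists>v\<in>V. ex v = e \<and> w e \<le> t * W v"
    proof
      fix e assume "e \<in> Ex"
      then obtain v where v: "e \<in> Es" "v \<in> e" "ex v = e" by (auto simp: Ex_def)
      then show "\<exists>v\<in>V. ex v = e \<and> w e \<le> t * W v"
        using t(2)[OF v(1,2)] edge[OF v(1)] by (intro bexI[of _ v]) auto
    qed
  qed (use fin finite_V in auto)
  also have "(\<Sum>v\<in>V. t * W v) = t" using sum_W by (simp flip: sum_distrib_left)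
  also have "(\<Sum>e\<in>(\<Union>g\<in>\<Gamma>. inner g). w e) = (\<Sum>g\<in>\<Gamma>. inner_weight (T g))"
    using fin finG inner_disj by (subst sum.UNION_disjoint) (auto simp: inner_weight_def inner_def)
  also have "\<dots> \<le> (\<Sum>g\<in>\<Gamma>. (l + (1 - l) * m) * Wt (T g))"
  proof (rule sum_mono)
    fix g assume "g \<in> \<Gamma>"
    then obtain v where v: "v \<in> V" "col v = Some g" by (auto simp: \<Gamma>_def)
    then have "g \<in> C" using col C(2) by blast
    then have le: "Wt (T g) \<le> m" using Wt_mono[OF T_sub(2) agree_subset] m by (meson order_trans)
    have "inner_weight (T g) \<le> l * Wt (T g) + (1 - l) * (Wt (T g))\<^sup>2"
      by (rule mixing_weaken[OF sp T_sub(1) l(1)])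
    moreover have "(Wt (T g))\<^sup>2 \<le> m * Wt (T g)"
      unfolding power2_eq_square using le Wt_nonneg[OF T_sub(1)] by (rule mult_right_mono)
    then have "(1 - l) * (Wt (T g))\<^sup>2 \<le> (1 - l) * (m * Wt (T g))"
      using l(3) by (intro mult_left_mono) auto
    ultimately show "inner_weight (T g) \<le> (l + (1 - l) * m) * Wt (T g)"
      by (simp add: algebra_simps)
  qed
  also have "\<dots> = (l + (1 - l) * m) * (\<Sum>g\<in>\<Gamma>. Wt (T g))" by (rule sum_distrib_left[symmetric])
  also have "\<dots> \<le> (l + (1 - l) * m) * 1"
  proof (rule mult_left_mono)
    have "(\<Sum>g\<in>\<Gamma>. Wt (T g)) = Wt (\<Union>g\<in>\<Gamma>. T g)"
      unfolding Wt_def using finG T_disj finT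
      by (subst sum.UNION_disjoint) auto
    also have "\<dots> \<le> 1" using T_sub(1) by (intro Wt_le_1) blast
    finally show "(\<Sum>g\<in>\<Gamma>. Wt (T g)) \<le> 1" .
    obtain g where "g \<in> C" using C(1) by blast
    then have "0 \<le> m" using m Wt_nonneg[OF agree_subset] by (meson order_trans)
    then show "0 \<le> l + (1 - l) * m" using l by simp
  qed
  finally show ?thesis by simp
qed

lemma bad_weight: "(\<Sum>e\<in>Es - Good. w e) = 1 - (\<Sum>e\<in>Good. w e)"
  using sum_diff[OF finite_Es Good, of w] sum_w by simp

lemma boundary_weight_le:
  "(\<Sum>e | e \<in> Es \<and> \<not> e \<subseteq> agree g \<and> e \<inter> agree g \<noteq> {}. w e) \<le>
    t * Wt (V - agree g) + (\<Sum>e\<in>Es - Good. w e)"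
proof -
  define A where "A = agree g"
  define B where "B = {e. e \<in> Es \<and> \<not> e \<subseteq> A \<and> e \<inter> A \<noteq> {}}"
  have finB: "finite B" using finite_Es by (simp add: B_def)
  define i where "i v = (THE e. e \<in> B \<inter> Good \<and> v \<in> e)" for v
  have i: "i v = e" if e: "e \<in> B \<inter> Good" "v \<in> e" and v: "v \<notin> A" for v e
    unfolding i_def
  proof (rule the_equality)
    have ends: "\<exists>u. e = {v, u} \<and> u \<in> A" if e: "e \<in> B \<inter> Good" "v \<in> e" for e
    proof -
      have "card e = 2" using e edge by (auto simp: B_def)
      then obtain u where u: "e = {v, u}" "u \<noteq> v" using card2_other e(2) by metis
      have "e \<inter> A \<noteq> {}" using e by (simp add: B_def)
      then show ?thesis using u v by auto
    qed
    show "e \<in> B \<inter> Good \<and> v \<in> e" using e by blast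
    fix e' assume e': "e' \<in> B \<inter> Good \<and> v \<in> e'"
    obtain u where u: "e = {v, u}" "u \<in> A" using ends[OF e] by blast
    obtain u' where u': "e' = {v, u'}" "u' \<in> A" using ends[of e'] e' by blast
    have "v \<in> V" using e edge[of e] by (auto simp: B_def)
    have "u = u'"
    proof (rule ccontr)
      assume "u \<noteq> u'"
      moreover have "{u, v} \<in> Good" "{v, u'} \<in> Good"
        using e e' u u' by (auto simp: insert_commute)
      ultimately have "g \<in> L v" using path u(2) u'(2) by (auto simp: A_def agree_def)
      then show False using v \<open>v \<in> V\<close> by (simp add: A_def agree_def)
    qed
    then show "e' = e" using u u' by simp
  qed
  have "(\<Sum>e\<in>B \<inter> Good. w e) \<le> (\<Sum>v\<in>V - A. t * W v)"
  proof (rule sum_le_included[where i = i])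
    show "\<forall>v\<in>V - A. 0 \<le> t * W v" using t(1) W_pos by (simp add: less_imp_le)
    show "\<forall>e\<in>B \<inter> Good. \<exists>v\<in>V - A. i v = e \<and> w e \<le> t * W v"
    proof
      fix e assume e: "e \<in> B \<inter> Good"
      then obtain v where v: "v \<in> e" "v \<notin> A" by (auto simp: B_def)
      have "e \<in> Es" using e by (simp add: B_def)
      then show "\<exists>v\<in>V - A. i v = e \<and> w e \<le> t * W v"
        using i[OF e v] t(2)[of e v] v edge[of e] by (intro bexI[of _ v]) auto
    qed
  qed (use finB finite_V in auto)
  also have "\<dots> = t * Wt (V - A)" by (simp add: Wt_def sum_distrib_left)
  finally have 1: "(\<Sum>e\<in>B \<inter> Good. w e) \<le> t * Wt (V - A)" .
  have 2: "(\<Sum>e\<in>B - Good. w e) \<le> (\<Sum>e\<in>Es - Good. w e)"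
    using finite_Es by (intro sum_mono2) (auto simp: B_def intro: w_nonneg)
  have "(\<Sum>e\<in>B. w e) = (\<Sum>e\<in>B \<inter> Good. w e) + (\<Sum>e\<in>B - Good. w e)"
    by (rule sum.Int_Diff[OF finB])
  then show ?thesis using 1 2 by (simp add: B_def A_def)
qed

lemma ex_close_constant:
  "\<exists>g\<in>C. (1 - l) * Wt (V - agree g) \<le> (\<Sum>e\<in>Es - Good. w e) + t \<and>
    2 * (1 - l) * (1 - Wt (V - agree g)) * Wt (V - agree g) - t * Wt (V - agree g) \<le> (\<Sum>e\<in>Es - Good. w e)"
proof -
  define M where "M = (\<lambda>g. Wt (agree g)) ` C"
  have "M \<subseteq> Wt ` Pow V" using agree_subset by (auto simp: M_def)
  then have finM: "finite M" by (rule finite_subset) (simp add: finite_V)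
  have "M \<noteq> {}" using C(1) by (simp add: M_def)
  then have "Max M \<in> M" using finM by simp
  then obtain g where g: "g \<in> C" and max: "Max M = Wt (agree g)" by (auto simp: M_def)
  have g_max: "Wt (agree h) \<le> Wt (agree g)" if "h \<in> C" for h
    unfolding max[symmetric] using that finM by (intro Max_ge) (auto simp: M_def)
  define b where "b = Wt (V - agree g)"
  have a: "Wt (agree g) = 1 - b" using Wt_compl[OF agree_subset] by (simp add: b_def)
  have "(\<Sum>e\<in>Good. w e) \<le> t + l + (1 - l) * (1 - b)" using good_weight_le[OF g_max] a by simp
  then have 1: "(1 - l) * b \<le> (\<Sum>e\<in>Es - Good. w e) + t" unfolding bad_weight by (simp add: algebra_simps)
  have "inner_weight (agree g) \<le> l * (1 - b) + (1 - l) * (1 - b)\<^sup>2"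
    using mixing_weaken[OF sp agree_subset l(1), of g] a by simp
  moreover have "2 * ((1 - b) - inner_weight (agree g)) \<le> t * b + (\<Sum>e\<in>Es - Good. w e)"
    using boundary_weight_ge[OF agree_subset, of g] boundary_weight_le[of g] a
    by (simp add: b_def)
  ultimately have "2 * (1 - l) * (1 - b) * b - t * b \<le> (\<Sum>e\<in>Es - Good. w e)"
    by (simp add: algebra_simps power2_eq_square)
  with 1 show ?thesis using g unfolding b_def by blast
qed

end

lemma expansion_arith:
  fixes b d t s \<kappa> M \<epsilon> :: real
  assumes M: "\<bar>\<kappa>\<bar> \<le> M" and \<epsilon>: "\<epsilon> = (2 - 4 * \<kappa> - 4 * M - 5 * t - 2 * s) / (5 - 2 * \<kappa>)" "0 < \<epsilon>"
    and k: "\<kappa> < 5 / 2" and ts: "0 \<le> t" "0 \<le> s" and b: "0 \<le> b" "b \<le> 1" and l: "l = max \<kappa> 0"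
    and 1: "(1 - l) * b \<le> d + t"
    and 2: "2 * (1 - l) * (1 - b) * b - t * b \<le> d"
  shows "\<epsilon> * b \<le> d"
proof (rule ccontr)
  assume "\<not> ?thesis"
  then have d: "d < \<epsilon> * b" by simp
  have num: "\<epsilon> * (5 - 2 * \<kappa>) = 2 - 4 * \<kappa> - 4 * M - 5 * t - 2 * s" using \<epsilon>(1) k by simp
  have pos: "0 < \<epsilon> * (5 - 2 * \<kappa>)" using \<epsilon>(2) k by simp
  have l0: "0 \<le> l" using l by simp
  have l4: "l \<le> 1 / 4" using pos num M ts l by (auto simp: max_def abs_if split: if_splits)
  have "\<epsilon> * (9 / 2) \<le> 2 - 8 * l - 5 * t"
  proof (cases "0 \<le> \<kappa>")
    case True
    then have "\<epsilon> * (9 / 2) \<le> \<epsilon> * (5 - 2 * \<kappa>)" using \<epsilon>(2) l4 l by (intro mult_left_mono) auto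
    then show ?thesis using num M ts l True by simp
  next
    case False
    then have "\<epsilon> * (9 / 2) \<le> \<epsilon> * (5 - 2 * \<kappa>)" using \<epsilon>(2) by (intro mult_left_mono) auto
    then show ?thesis using num M ts l False by simp
  qed
  then have e: "3 * \<epsilon> \<le> 2 - 2 * l - 3 * t" using l0 l4 ts pos num by linarith
  have "b > 0" using d b \<epsilon>(2) by (cases "b = 0") (use 2 in auto)
  have "(2 * (1 - l) - 2 * (d + t) - t) * b \<le> (2 * (1 - l) - 2 * ((1 - l) * b) - t) * b"
    using 1 b by (intro mult_right_mono) auto
  also have "\<dots> \<le> d" using 2 by (simp add: algebra_simps)
  also have "\<dots> < \<epsilon> * b" by (rule d)
  finally have "2 * (1 - l) - 2 * (d + t) - t < \<epsilon>" using \<open>b > 0\<close> by simp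
  moreover have "\<epsilon> * b \<le> \<epsilon> * 1" using b \<epsilon>(2) by (intro mult_left_mono) auto
  ultimately show False using e d by simp
qed

section \<open>Linear disjointness\<close>

lemma (in group) eq_if_mult_inv_eq_one:
  assumes "a \<in> carrier G" "b \<in> carrier G" "a \<otimes> inv b = \<one>"
  shows "a = b"
  using assms by (metis inv_closed inv_equality inv_inv)

lemma (in group) mult_inv_telescope:
  assumes "a \<in> carrier G" "b \<in> carrier G" "c \<in> carrier G"
  shows "(a \<otimes> inv b) \<otimes> (b \<otimes> inv c) = a \<otimes> inv c"
  using assms by (simp add: m_assoc inv_solve_left) (metis inv_closed l_inv l_one m_assoc)

context comm_group
begin

lemma linearly_disjoint_eq_one:
  assumes ld: "linearly_disjoint G S Y" and finY: "finite Y"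
    and S: "\<And>y. y \<in> Y \<Longrightarrow> \<one> \<in> S y \<and> S y \<subseteq> carrier G"
    and h: "inj_on h J" "h ` J \<subseteq> Y"
    and q: "\<And>j. j \<in> J \<Longrightarrow> q j \<in> S (h j)" "finprod G q J = \<one>"
    and j: "j \<in> J"
  shows "q j = \<one>"
proof -
  define r where "r = (\<lambda>y\<in>Y. if y \<in> h ` J then q (inv_into J h y) else \<one>)"
  define r0 where "r0 = (\<lambda>y\<in>Y. \<one>)"
  have r_h: "r (h i) = q i" if "i \<in> J" for i
    using that h by (auto simp: r_def inv_into_f_f)
  have r: "r \<in> Pi\<^sub>E Y S" and r0: "r0 \<in> Pi\<^sub>E Y S"
    using q(1) S h by (auto simp: r_def r0_def inv_into_f_f)
  have rc: "r \<in> Y \<rightarrow> carrier G" using r S by (fastforce simp: PiE_iff)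
  have "finprod G r Y = finprod G r (h ` J)"
    using rc h finY by (intro finprod_mono_neutral_cong_right) (auto simp: r_def)
  also have "\<dots> = finprod G (\<lambda>i. r (h i)) J"
    using rc h by (intro finprod_reindex) auto
  also have "\<dots> = finprod G q J"
    using q(1) S h r_h by (intro finprod_cong') auto
  also have "\<dots> = finprod G r0 Y"
    using q(2) by (simp add: r0_def finprod_one_eqI)
  finally have "r = r0"
    using inj_onD[OF ld[unfolded linearly_disjoint_def] _ r r0] by simp
  moreover have "h j \<in> Y" using h j by blast
  ultimately have "r (h j) = \<one>" by (simp add: r0_def)
  then show ?thesis using r_h[OF j] by simp
qed

lemma finprod_nth:
  assumes "set zs \<subseteq> carrier G"
  shows "finprod G (nth zs) {..<length zs} = foldr (\<otimes>) zs \<one>"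
  using assms
proof (induction zs)
  case (Cons z zs)
  have nth: "zs ! i \<in> carrier G" if "i < length zs" for i using that Cons.prems by auto
  have "finprod G (nth (z # zs)) {..<length (z # zs)} = finprod G (nth (z # zs)) (insert 0 (Suc ` {..<length zs}))"
    by (simp add: lessThan_Suc_eq_insert_0)
  also have "\<dots> = z \<otimes> finprod G (nth (z # zs)) (Suc ` {..<length zs})"
    using Cons.prems nth by (subst finprod_insert) auto
  also have "finprod G (nth (z # zs)) (Suc ` {..<length zs}) = finprod G (nth zs) {..<length zs}"
    using nth by (subst finprod_reindex) auto
  finally show ?case using Cons by simp
qed simp

lemma linearly_disjoint_list:
  assumes ld: "linearly_disjoint G S Y" and finY: "finite Y"
    and S: "\<And>y. y \<in> Y \<Longrightarrow> \<one> \<in> S y \<and> S y \<subseteq> carrier G"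
    and ys: "distinct ys" "set ys \<subseteq> Y"
    and zs: "list_all2 (\<lambda>y z. z \<in> S y) ys zs" "foldr (\<otimes>) zs \<one> = \<one>"
    and z: "z \<in> set zs"
  shows "z = \<one>"
proof -
  have len: "length zs = length ys" using zs(1) by (simp add: list_all2_lengthD)
  have nth: "zs ! i \<in> S (ys ! i)" if "i < length ys" for i
    using zs(1) that by (rule list_all2_nthD)
  have sub: "set zs \<subseteq> carrier G"
  proof
    fix x assume "x \<in> set zs"
    then obtain i where "i < length ys" "x = zs ! i" by (auto simp: in_set_conv_nth len)
    then show "x \<in> carrier G" using nth S ys(2) by (meson nth_mem subsetD)
  qed
  obtain j where j: "j < length zs" "z = zs ! j" using z by (auto simp: in_set_conv_nth)
  have "zs ! j = \<one>"
  proof (rule linearly_disjoint_eq_one[OF ld finY S, where h = "nth ys" and J = "{..<length zs}" and q = "nth zs"])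
    show "inj_on (nth ys) {..<length zs}" using ys(1) len by (simp add: inj_on_nth)
    show "nth ys ` {..<length zs} \<subseteq> Y" using ys(2) len by auto
    show "finprod G (nth zs) {..<length zs} = \<one>" using finprod_nth[OF sub] zs(2) by simp
  qed (use nth len j in auto)
  then show ?thesis using j by simp
qed

lemma finprod_cyclic_differences:
  assumes x: "x \<in> {..<l} \<rightarrow> carrier G" and y: "y \<in> {..<l} \<rightarrow> carrier G"
    and \<sigma>: "bij_betw \<sigma> {..<l} {..<l}"
  shows "finprod G (\<lambda>i. x i \<otimes> inv y i) {..<l} \<otimes> finprod G (\<lambda>i. y i \<otimes> inv x (\<sigma> i)) {..<l} = \<one>"
proof -
  have \<sigma>_mem: "\<sigma> i < l" if "i < l" for i using that \<sigma> by (auto simp: bij_betw_def)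
  have x\<sigma>: "(\<lambda>i. inv x (\<sigma> i)) \<in> {..<l} \<rightarrow> carrier G" using x \<sigma>_mem by auto
  have ix: "(\<lambda>i. inv x i) \<in> {..<l} \<rightarrow> carrier G" using x by auto
  have "finprod G (\<lambda>i. x i \<otimes> inv y i) {..<l} \<otimes> finprod G (\<lambda>i. y i \<otimes> inv x (\<sigma> i)) {..<l} =
      finprod G (\<lambda>i. (x i \<otimes> inv y i) \<otimes> (y i \<otimes> inv x (\<sigma> i))) {..<l}"
    using x y x\<sigma> by (subst finprod_multf) auto
  also have "\<dots> = finprod G (\<lambda>i. x i \<otimes> inv x (\<sigma> i)) {..<l}"
    using x y \<sigma>_mem by (intro finprod_cong') (auto simp: mult_inv_telescope Pi_iff)
  also have "\<dots> = finprod G x {..<l} \<otimes> finprod G (\<lambda>i. inv x (\<sigma> i)) {..<l}"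
    using x x\<sigma> by (intro finprod_multf) auto
  also have "finprod G (\<lambda>i. inv x (\<sigma> i)) {..<l} = finprod G (\<lambda>i. inv x i) (\<sigma> ` {..<l})"
    using \<sigma> ix by (subst finprod_reindex) (auto simp: bij_betw_def)
  also have "\<sigma> ` {..<l} = {..<l}" using \<sigma> by (simp add: bij_betw_def)
  also have "finprod G x {..<l} \<otimes> finprod G (\<lambda>i. inv x i) {..<l} = finprod G (\<lambda>i. x i \<otimes> inv x i) {..<l}"
    using x ix by (intro finprod_multf[symmetric]) auto
  also have "\<dots> = \<one>" using x by (intro finprod_one_eqI) (simp add: Pi_iff)
  finally show ?thesis .
qed

end

lemma subset_doubleton_iff: "x \<subseteq> {a, b} \<longleftrightarrow> x = {} \<or> x = {a} \<or> x = {b} \<or> x = {a, b}"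
  by auto

lemma cycle_of_length_list:
  assumes X: "\<And>x y. x \<in> X \<Longrightarrow> y \<subseteq> x \<Longrightarrow> y \<in> X" and E: "\<And>e. e \<in> E \<Longrightarrow> e \<in> X"
    and p: "edges_cycle E p" and l: "l = length p"
  shows "cycle_of_length X l
    ({{}} \<union> (\<lambda>i. {p ! i}) ` {..<l} \<union> (\<lambda>i. {p ! i, p ! ((i + 1) mod l)}) ` {..<l})"
    (is "cycle_of_length X l ?Y")
    and "\<And>i. i < l \<Longrightarrow> {p ! i, p ! ((i + 1) mod l)} \<in> E"
proof -
  have l3: "3 \<le> l" and dist: "distinct p" using p l by (auto simp: edges_cycle_def edges_path_def)
  show e: "{p ! i, p ! ((i + 1) mod l)} \<in> E" if "i < l" for i
  proof (cases "i + 1 = l")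
    case True
    have "p \<noteq> []" using l3 l by auto
    moreover have "i = length p - 1" "(i + 1) mod l = 0" using True l by simp_all
    ultimately have "p ! i = last p" "p ! ((i + 1) mod l) = hd p"
      by (simp_all add: last_conv_nth hd_conv_nth)
    then show ?thesis using p by (simp add: edges_cycle_def)
  next
    case False
    then show ?thesis using p that l by (simp add: edges_cycle_def edges_path_def successively_conv_nth)
  qed
  have modl: "(i + 1) mod l < l" for i using l3 by simp
  have "?Y \<subseteq> X"
  proof -
    have "{p ! i, p ! ((i + 1) mod l)} \<in> X" if "i < l" for i using e E that by blast
    moreover from this have "{p ! i} \<in> X" if "i < l" for i using X that by blast
    moreover from this[of 0] have "{} \<in> X" using X l3 by fastforce
    ultimately show ?thesis by blast
  qed
  moreover have "graph ?Y"
    unfolding graph_def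
  proof (intro conjI ballI allI impI)
    fix x assume x: "x \<in> ?Y"
    then show "finite x" by auto
    show "card x \<le> 2" using x by (auto simp: card_insert_if)
    fix z assume z: "z \<subseteq> x"
    from x consider "x = {}" | i where "i < l" "x = {p ! i}"
      | i where "i < l" "x = {p ! i, p ! ((i + 1) mod l)}" by blast
    then show "z \<in> ?Y"
    proof cases
      case 3
      then have "z = {} \<or> z = {p ! i} \<or> z = {p ! ((i + 1) mod l)} \<or> z = x"
        using z by (simp add: subset_doubleton_iff)
      then show ?thesis
        by (elim disjE) (use 3 x modl[of i] in auto)
    qed (use z in \<open>auto simp: subset_singleton_iff\<close>)
  qed auto
  moreover have "graph_isomorphic (cycle_graph l) ?Y"
    unfolding graph_isomorphic_def
  proof (intro exI conjI)
    have 1: "\<Union> (cycle_graph l) = {..<l}" using modl by (auto simp: cycle_graph_def)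
    have 2: "\<Union> ?Y = nth p ` {..<l}" using modl by auto
    show "bij_betw (nth p) (\<Union> (cycle_graph l)) (\<Union> ?Y)"
      unfolding 1 2 using dist l by (auto simp: bij_betw_def inj_on_nth)
    show "(\<lambda>x. nth p ` x) ` cycle_graph l = ?Y"
      unfolding cycle_graph_def image_Un image_image by simp
  qed
  ultimately show "cycle_of_length X l ?Y" using l3 by (simp add: cycle_of_length_def subgraph_def)
qed

lemma path_of_length_2:
  assumes X: "\<And>x y. x \<in> X \<Longrightarrow> y \<subseteq> x \<Longrightarrow> y \<in> X" and e: "{u, v} \<in> X" "{v, u'} \<in> X"
    and ne: "u \<noteq> v" "v \<noteq> u'" "u \<noteq> u'"
  shows "path_of_length X 2 {{}, {u}, {v}, {u'}, {u, v}, {v, u'}}" (is "path_of_length X 2 ?Y")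
proof -
  have "?Y \<subseteq> X" using X[OF e(1)] X[OF e(2)] e by auto
  moreover have "graph ?Y"
    using ne by (simp add: graph_def subset_doubleton_iff subset_singleton_iff)
  moreover have "\<exists>vs. length vs = 2 + 1 \<and> (\<forall>i<2. vs ! i \<noteq> vs ! (i + 1)) \<and>
        inj_on (\<lambda>i. {vs ! i, vs ! (i + 1)}) {..<2} \<and>
        ?Y = {{}} \<union> (\<lambda>v. {v}) ` set vs \<union> (\<lambda>i. {vs ! i, vs ! (i + 1)}) ` {..<2}"
  proof (intro exI[of _ "[u, v, u']"] conjI)
    show "\<forall>i<2. [u, v, u'] ! i \<noteq> [u, v, u'] ! (i + 1)" using ne by (auto simp: less_2_cases_iff)
    show "inj_on (\<lambda>i. {[u, v, u'] ! i, [u, v, u'] ! (i + 1)}) {..<2}"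
      using ne by (auto simp: inj_on_def less_2_cases_iff doubleton_eq_iff)
    show "?Y = {{}} \<union> (\<lambda>v. {v}) ` set [u, v, u'] \<union> (\<lambda>i. {[u, v, u'] ! i, [u, v, u'] ! (i + 1)}) ` {..<2}"
      by (auto simp: numeral_2_eq_2 lessThan_Suc)
  qed simp
  ultimately show ?thesis by (simp add: path_of_length_def subgraph_def)
qed

section \<open>Cochains of the quotient sheaf\<close>

locale coset_cochain = wgraph X w + comm_group R
  for X :: "'a::linorder set set" and w and R :: "'r monoid" (structure) +
  fixes S :: "'a set \<Rightarrow> 'r set" and f :: "'a set \<Rightarrow> 'r set"
    and G :: "'a set \<Rightarrow> 'r set" and F :: "('a, 'r set) sheaf_data"
  assumes S_nonempty: "x \<in> X \<Longrightarrow> x \<noteq> {} \<Longrightarrow> subgroup (S x) R" and S_empty: "S {} = {\<one>}"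
    and G_def: "G = (\<lambda>x. subgroup_sum R S {y \<in> X. y \<subseteq> x})"
    and F_def: "F = quotient_sheaf (const_sheaf R) G"
    and cycle_disjoint: "cycle_of_length X l Y \<Longrightarrow> 3 * l \<le> 2 * (card V + 1) \<Longrightarrow> linearly_disjoint R S Y"
    and path_disjoint: "path_of_length X 2 Y \<Longrightarrow> linearly_disjoint R S Y"
    and pair_disjoint: "u \<in> V \<Longrightarrow> v \<in> V \<Longrightarrow> u \<noteq> v \<Longrightarrow> linearly_disjoint R S {{u}, {v}}"
    and f: "f \<in> carrier (cochains X F 0)"
begin

definition L :: "'a \<Rightarrow> 'r set" where "L v = f {v}"

definition Good :: "'a set set" where "Good = {e \<in> Es. d0 X F f e = \<one>\<^bsub>grp F e\<^esub>}"

lemma S_subgroup: "x \<in> X \<Longrightarrow> subgroup (S x) R"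
  using S_nonempty S_empty triv_subgroup by (cases "x = {}") auto

lemma S_closed: "x \<in> X \<Longrightarrow> \<one> \<in> S x \<and> S x \<subseteq> carrier R"
  using S_subgroup subgroup.subset subgroup.one_closed by blast

lemma graph_X: "graph X"
  using wg by (simp add: weighted_graph_def)

lemma grp_F: "grp F x = R Mod G x"
  by (simp add: F_def quotient_sheaf_def const_sheaf_def)

lemma const_subsheaf_G: "const_subsheaf X R G"
  unfolding G_def by (rule const_subsheaf_subgroup_sum[OF comm_group_axioms graph_X S_subgroup])

lemma G_subgroup: "x \<in> X \<Longrightarrow> subgroup (G x) R"
  using const_subsheaf_G by (simp add: const_subsheaf_def)

lemma group_F: "x \<in> X \<Longrightarrow> group (grp F x)"
  using sheaf_quotient_sheaf(1)[OF comm_group_axioms const_subsheaf_G]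
  by (simp add: sheaf_def F_def[symmetric] comm_group_def)

lemma res_F: "x \<in> X \<Longrightarrow> y \<in> X \<Longrightarrow> x \<subseteq> y \<Longrightarrow> a \<in> carrier R \<Longrightarrow> res F x y (G x #> a) = G y #> a"
  unfolding F_def by (rule sheaf_quotient_sheaf(2)[OF comm_group_axioms const_subsheaf_G])

lemma empty_in_X: "{} \<in> X"
  using graph_X by (auto simp: graph_def)

lemma G_vertex:
  assumes v: "v \<in> V" shows "G {v} = S {v}"
proof -
  have I: "{y \<in> X. y \<subseteq> {v}} = {{}, {v}}"
    using singleton_in_X[OF v] empty_in_X by (auto simp: subset_singleton_iff)
  have sum: "finprod R r {{}, {v}} = r {v}" if "r {} = \<one>" "r {v} \<in> S {v}" for r
    using that S_closed[OF singleton_in_X[OF v]] by (subst finprod_insert) auto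
  have "r {v} \<in> S {v}" "r {} = \<one>" if "r \<in> Pi\<^sub>E {{}, {v}} S" for r
    using that S_empty by (auto simp: PiE_iff)
  then have "G {v} \<subseteq> S {v}"
    unfolding G_def I subgroup_sum_def using sum by auto
  moreover have "S {v} \<subseteq> G {v}"
  proof
    fix z assume z: "z \<in> S {v}"
    define r where "r = (\<lambda>y\<in>{{}, {v}}. if y = {} then \<one> else z)"
    have "r \<in> Pi\<^sub>E {{}, {v}} S" using z S_empty by (auto simp: r_def)
    moreover have "finprod R r {{}, {v}} = z" using sum[of r] z by (simp add: r_def)
    ultimately show "z \<in> G {v}" unfolding G_def I subgroup_sum_def by (metis image_eqI)
  qed
  ultimately show ?thesis by blast
qed

lemma G_edge:
  assumes e: "{u, v} \<in> X" "u \<noteq> v" and z: "z \<in> G {u, v}"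
  obtains a b c where "a \<in> S {u}" "b \<in> S {v}" "c \<in> S {u, v}" "z = a \<otimes> b \<otimes> c"
proof -
  have V: "{u} \<in> X" "{v} \<in> X" using subface[OF e(1)] by auto
  have I: "{y \<in> X. y \<subseteq> {u, v}} = {{}, {u}, {v}, {u, v}}"
    using V empty_in_X e by (auto simp: subset_doubleton_iff)
  obtain r where r: "r \<in> Pi\<^sub>E {{}, {u}, {v}, {u, v}} S" "z = finprod R r {{}, {u}, {v}, {u, v}}"
    using z unfolding G_def I subgroup_sum_def by blast
  have mem: "r {} = \<one>" "r {u} \<in> S {u}" "r {v} \<in> S {v}" "r {u, v} \<in> S {u, v}"
    using r(1) S_empty by (auto simp: PiE_iff)
  have c: "r {u} \<in> carrier R" "r {v} \<in> carrier R" "r {u, v} \<in> carrier R"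
    using mem S_closed V e(1) by blast+
  have "z = r {u} \<otimes> (r {v} \<otimes> r {u, v})"
    unfolding r(2) using c mem(1) e(2) by (simp add: doubleton_eq_iff)
  then show thesis using that[OF mem(2-4)] c by (simp add: m_assoc)
qed

lemma L_coset:
  assumes v: "v \<in> V"
  obtains a where "a \<in> carrier R" "L v = S {v} #> a"
proof -
  have "f {v} \<in> carrier (R Mod G {v})"
    using f v by (auto simp: cochains_def grp_F vertex_faces PiE_iff)
  then show thesis using that G_vertex[OF v] by (auto simp: carrier_FactGroup L_def)
qed

lemma L_carrier: assumes "v \<in> V" shows "L v \<subseteq> carrier R"
proof -
  obtain a where a: "a \<in> carrier R" "L v = S {v} #> a" using L_coset[OF assms] .
  have "S {v} \<subseteq> carrier R" using S_closed[OF singleton_in_X[OF assms]] ..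
  then show ?thesis unfolding a(2) using a(1) by (rule r_coset_subset_G)
qed

lemma L_eq_coset:
  assumes v: "v \<in> V" and g: "g \<in> L v"
  shows "L v = S {v} #> g"
proof -
  obtain a where "a \<in> carrier R" "L v = S {v} #> a" using L_coset[OF v] .
  then show ?thesis using repr_independence[OF _ _ S_subgroup[OF singleton_in_X[OF v]]] g by metis
qed

lemma L_difference:
  assumes v: "v \<in> V" and g: "g \<in> L v" and h: "h \<in> L v"
  shows "g \<otimes> inv h \<in> S {v}"
proof -
  have c: "g \<in> carrier R" "h \<in> carrier R" using L_carrier[OF v] g h by auto
  have "g \<in> S {v} #> h" using g L_eq_coset[OF v h] by simp
  then obtain s where s: "s \<in> S {v}" "g = s \<otimes> h" by (auto simp: r_coset_def)
  have "s \<in> carrier R" using s S_closed[OF singleton_in_X[OF v]] by blast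
  then have "g \<otimes> inv h = s" using s c by (simp add: m_assoc)
  then show ?thesis using s by simp
qed

lemma Good_subset: "Good \<subseteq> Es"
  by (auto simp: Good_def)

lemma good_edge_Max_Min:
  assumes e: "e \<in> Good"
  shows "e = {Max e, Min e}" "Max e \<noteq> Min e"
    "\<exists>x\<in>L (Max e). \<exists>y\<in>L (Min e). x \<otimes> inv y \<in> S e"
proof -
  have eE: "e \<in> Es" using e Good_subset by blast
  then obtain a b where ab: "e = {a, b}" "a \<noteq> b" using edge by (meson card_2_iff)
  show eq: "e = {Max e, Min e}" using ab by (cases "a < b") (auto simp: max_def min_def)
  show ne: "Max e \<noteq> Min e" using ab by (auto simp: max_def min_def)
  define M m where "M = Max e" and "m = Min e"
  have eq: "e = {M, m}" and ne: "M \<noteq> m" using eq ne by (simp_all add: M_def m_def)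
  have eX: "e \<in> X" using edge_in_X[OF eE] .
  have MV: "M \<in> V" "m \<in> V" using edge[OF eE] eq by auto
  obtain a where a: "a \<in> carrier R" "L M = S {M} #> a" using L_coset[OF MV(1)] .
  obtain b where b: "b \<in> carrier R" "L m = S {m} #> b" using L_coset[OF MV(2)] .
  have sing: "{M} \<in> X" "{m} \<in> X" using singleton_in_X MV by auto
  have "f {M} = G {M} #> a" "f {m} = G {m} #> b" using a b G_vertex MV by (simp_all add: L_def)
  then have "res F {M} e (f {M}) = G e #> a" "res F {m} e (f {m}) = G e #> b"
    using res_F[OF sing(1) eX _ a(1)] res_F[OF sing(2) eX _ b(1)] eq by auto
  moreover have "d0 X F f e = res F {M} e (f {M}) \<otimes>\<^bsub>grp F e\<^esub> inv\<^bsub>grp F e\<^esub> res F {m} e (f {m})"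
    using eE by (simp add: d0_def M_def m_def Es_def)
  moreover have "d0 X F f e = \<one>\<^bsub>grp F e\<^esub>" using e by (simp add: Good_def)
  ultimately have "(G e #> a) \<otimes>\<^bsub>grp F e\<^esub> inv\<^bsub>grp F e\<^esub> (G e #> b) = \<one>\<^bsub>grp F e\<^esub>"
    by simp
  moreover have "G e #> a \<in> carrier (grp F e)" "G e #> b \<in> carrier (grp F e)"
    using a b by (auto simp: grp_F carrier_FactGroup)
  ultimately have "G e #> a = G e #> b" using group.eq_if_mult_inv_eq_one[OF group_F[OF eX]] by blast
  then have "a \<in> G e #> b" using rcos_self[OF a(1) G_subgroup[OF eX]] by simp
  then obtain z where z: "z \<in> G e" "a = z \<otimes> b" by (auto simp: r_coset_def)
  obtain p q c where pqc: "p \<in> S {M}" "q \<in> S {m}" "c \<in> S e" "z = p \<otimes> q \<otimes> c"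
    using G_edge[of M m z] eX ne z(1) unfolding eq by metis
  have carr: "p \<in> carrier R" "q \<in> carrier R" "c \<in> carrier R"
    using pqc S_closed sing eX by blast+
  have "inv p \<in> S {M}" using S_subgroup[OF sing(1)] pqc(1) by (rule subgroup.m_inv_closed)
  then have x: "inv p \<otimes> a \<in> L M" using a by (auto simp: r_coset_def)
  have y: "q \<otimes> b \<in> L m" using b pqc by (auto simp: r_coset_def)
  have "inv p \<otimes> a = c \<otimes> (q \<otimes> b)"
    unfolding z(2) pqc(4) using carr b(1) by (simp add: m_assoc inv_solve_left') (simp add: m_ac)
  then have "(inv p \<otimes> a) \<otimes> inv (q \<otimes> b) = c"
    using carr b(1) by (simp add: m_assoc)
  then show "\<exists>x\<in>L (Max e). \<exists>y\<in>L (Min e). x \<otimes> inv y \<in> S e"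
    using x y pqc(3) unfolding M_def m_def by metis
qed

lemma good_edge:
  assumes e: "{u, v} \<in> Good"
  shows "\<exists>x y. x \<in> L u \<and> y \<in> L v \<and> x \<otimes> inv y \<in> S {u, v}"
proof -
  define M m where "M = Max {u, v}" and "m = Min {u, v}"
  have eX: "{u, v} \<in> X" using e Good_subset edge_in_X by blast
  have V: "M \<in> V" "m \<in> V" using good_edge_Max_Min(1)[OF e] edge[of "{u, v}"] e Good_subset
    unfolding M_def m_def by blast+
  obtain x y where xy: "x \<in> L M" "y \<in> L m" "x \<otimes> inv y \<in> S {u, v}"
    using good_edge_Max_Min(3)[OF e] unfolding M_def m_def by blast
  have "{u, v} = {M, m}" unfolding M_def m_def by (rule good_edge_Max_Min(1)[OF e])
  then consider "M = u" "m = v" | "M = v" "m = u" by (auto simp: doubleton_eq_iff)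
  then show ?thesis
  proof cases
    case 1
    then show ?thesis using xy by blast
  next
    case 2
    have "x \<in> carrier R" "y \<in> carrier R" using xy L_carrier V by blast+
    then have "inv (x \<otimes> inv y) = y \<otimes> inv x" by (simp add: inv_mult_group)
    moreover have "inv (x \<otimes> inv y) \<in> S {u, v}"
      using S_subgroup[OF eX] xy(3) by (rule subgroup.m_inv_closed)
    ultimately show ?thesis using 2 xy by auto
  qed
qed

lemma L_unique:
  assumes uv: "u \<in> V" "v \<in> V" "u \<noteq> v" and g: "g \<in> L u \<inter> L v" and h: "h \<in> L u \<inter> L v"
  shows "g = h"
proof -
  have c: "g \<in> carrier R" "h \<in> carrier R" using g h L_carrier uv by blast+
  have 1: "g \<otimes> inv h \<in> S {u}" "h \<otimes> inv g \<in> S {v}" using L_difference uv g h by auto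
  have S: "\<one> \<in> S y \<and> S y \<subseteq> carrier R" if "y \<in> {{u}, {v}}" for y
    using that S_closed singleton_in_X uv by blast
  have "g \<otimes> inv h = \<one>"
  proof (rule linearly_disjoint_list[OF pair_disjoint[OF uv] _ S])
    show "distinct [{u}, {v}]" "set [{u}, {v}] \<subseteq> {{u}, {v}}" using uv by auto
    show "list_all2 (\<lambda>y z. z \<in> S y) [{u}, {v}] [g \<otimes> inv h, h \<otimes> inv g]" using 1 by simp
    show "foldr (\<otimes>) [g \<otimes> inv h, h \<otimes> inv g] \<one> = \<one>" using c by (simp add: mult_inv_telescope)
  qed auto
  then show ?thesis using c eq_if_mult_inv_eq_one by blast
qed

lemma L_path:
  assumes e: "{u, v} \<in> Good" "{v, u'} \<in> Good" and ne: "u \<noteq> u'" and g: "g \<in> L u" "g \<in> L u'"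
  shows "g \<in> L v"
proof -
  have E: "{u, v} \<in> Es" "{v, u'} \<in> Es" using e Good_subset by auto
  then have X: "{u, v} \<in> X" "{v, u'} \<in> X" using edge_in_X by auto
  have V: "u \<in> V" "v \<in> V" "u' \<in> V" using edge[OF E(1)] edge[OF E(2)] by auto
  have neq: "u \<noteq> v" "v \<noteq> u'" using edge[OF E(1)] edge[OF E(2)] by auto
  obtain x y where xy: "x \<in> L u" "y \<in> L v" "x \<otimes> inv y \<in> S {u, v}"
    using good_edge[OF e(1)] by blast
  obtain y' x' where xy': "y' \<in> L v" "x' \<in> L u'" "y' \<otimes> inv x' \<in> S {v, u'}"
    using good_edge[OF e(2)] by blast
  have c: "x \<in> carrier R" "y \<in> carrier R" "x' \<in> carrier R" "y' \<in> carrier R" "g \<in> carrier R"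
    using xy xy' g L_carrier V by blast+
  let ?Y = "{{}, {u}, {v}, {u'}, {u, v}, {v, u'}}"
  let ?ys = "[{u}, {u, v}, {v}, {v, u'}, {u'}]"
  let ?zs = "[g \<otimes> inv x, x \<otimes> inv y, y \<otimes> inv y', y' \<otimes> inv x', x' \<otimes> inv g]"
  have ld: "linearly_disjoint R S ?Y"
    by (rule path_disjoint, rule path_of_length_2[OF subface X neq ne])
  have S: "\<one> \<in> S y \<and> S y \<subseteq> carrier R" if "y \<in> ?Y" for y
    using that S_closed[OF empty_in_X] S_closed[OF X(1)] S_closed[OF X(2)] S_closed[OF singleton_in_X] V
    by auto
  have dist: "distinct ?ys" using ne neq by (auto simp: doubleton_eq_iff)
  have mem: "list_all2 (\<lambda>y z. z \<in> S y) ?ys ?zs"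
    using xy xy' L_difference V g by simp
  have prod: "foldr (\<otimes>) ?zs \<one> = \<one>" using c by (simp add: mult_inv_telescope)
  have one: "z = \<one>" if "z \<in> set ?zs" for z
    by (rule linearly_disjoint_list[OF ld _ S dist _ mem prod that]) auto
  have "g \<otimes> inv x = \<one>" "x \<otimes> inv y = \<one>" by (rule one, simp)+
  then have "g = x" "x = y" using c by (blast intro: eq_if_mult_inv_eq_one)+
  then show ?thesis using xy by simp
qed

lemma L_cycle:
  assumes p: "edges_cycle Good p" and len: "3 * length p \<le> 2 * (card V + 1)"
  shows "\<exists>g. \<forall>v\<in>set p. g \<in> L v"
proof -
  define l where "l = length p"
  have l3: "3 \<le> l" and dist: "distinct p" using p by (auto simp: l_def edges_cycle_def edges_path_def)
  define \<sigma> where "\<sigma> i = (i + 1) mod l" for i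
  define \<epsilon> where "\<epsilon> i = {p ! i, p ! \<sigma> i}" for i
  let ?Y = "{{}} \<union> (\<lambda>i. {p ! i}) ` {..<l} \<union> (\<lambda>i. {p ! i, p ! ((i + 1) mod l)}) ` {..<l}"
  have GX: "e \<in> X" if "e \<in> Good" for e using that Good_subset edge_in_X by blast
  have cyc: "cycle_of_length X l ?Y" "\<And>i. i < l \<Longrightarrow> {p ! i, p ! ((i + 1) mod l)} \<in> Good"
    by (rule cycle_of_length_list[of X Good p l]; use subface GX p l_def in blast)+
  have ld: "linearly_disjoint R S ?Y" using cycle_disjoint[OF cyc(1)] len by (simp add: l_def)
  have \<epsilon>: "\<epsilon> i \<in> Good" if "i < l" for i using cyc(2)[OF that] by (simp add: \<epsilon>_def \<sigma>_def)
  have \<sigma>_less: "\<sigma> i < l" for i using l3 by (simp add: \<sigma>_def)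
  have pV: "p ! i \<in> V" if "i < l" for i using edge[of "\<epsilon> i"] \<epsilon>[OF that] Good_subset by (auto simp: \<epsilon>_def)
  have inj_p: "p ! i = p ! j \<longleftrightarrow> i = j" if "i < l" "j < l" for i j
    using that dist by (simp add: l_def nth_eq_iff_index_eq)
  have \<sigma>_Suc: "\<sigma> i = (if i + 1 = l then 0 else i + 1)" if "i < l" for i using that by (simp add: \<sigma>_def)
  have bij: "bij_betw \<sigma> {..<l} {..<l}"
  proof -
    have "inj_on \<sigma> {..<l}" by (auto simp: inj_on_def \<sigma>_Suc split: if_splits)
    moreover have "\<sigma> ` {..<l} \<subseteq> {..<l}" using \<sigma>_less by auto
    ultimately show ?thesis by (simp add: bij_betw_def endo_inj_surj)
  qed
  have "\<exists>x y. x \<in> L (p ! i) \<and> y \<in> L (p ! \<sigma> i) \<and> x \<otimes> inv y \<in> S (\<epsilon> i)" if "i < l" for i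
    using good_edge \<epsilon>[OF that] unfolding \<epsilon>_def by blast
  then obtain x y where xy: "\<And>i. i < l \<Longrightarrow> x i \<in> L (p ! i)" "\<And>i. i < l \<Longrightarrow> y i \<in> L (p ! \<sigma> i)"
      "\<And>i. i < l \<Longrightarrow> x i \<otimes> inv y i \<in> S (\<epsilon> i)"
    by metis
  have c: "x i \<in> carrier R" "y i \<in> carrier R" if "i < l" for i
    using xy[OF that] L_carrier pV that \<sigma>_less by blast+
  define h where "h = case_sum \<epsilon> (\<lambda>i. {p ! \<sigma> i})"
  define q where "q = case_sum (\<lambda>i. x i \<otimes> inv y i) (\<lambda>i. y i \<otimes> inv x (\<sigma> i))"
  let ?J = "{..<l} <+> {..<l}"
  have h_inj: "inj_on h ?J"
  proof (rule inj_onI)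
    have two: "\<epsilon> i \<noteq> {p ! j}" if "i < l" for i j
      using edge[of "\<epsilon> i"] \<epsilon>[OF that] Good_subset by auto
    have edges: "i = j" if "i < l" "j < l" "\<epsilon> i = \<epsilon> j" for i j
      using that l3 by (auto simp: \<epsilon>_def doubleton_eq_iff inj_p \<sigma>_less \<sigma>_Suc split: if_splits)
    have vertices: "i = j" if "i < l" "j < l" "p ! \<sigma> i = p ! \<sigma> j" for i j
      using that bij by (auto simp: inj_p \<sigma>_less bij_betw_def inj_on_def)
    fix a b assume "a \<in> ?J" "b \<in> ?J" "h a = h b"
    then show "a = b"
      using two two[symmetric] by (auto simp: h_def dest: edges vertices)
  qed
  have h_Y: "h ` ?J \<subseteq> ?Y" using \<sigma>_less by (auto simp: h_def \<epsilon>_def \<sigma>_def)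
  have q_S: "q j \<in> S (h j)" if "j \<in> ?J" for j
    using that xy L_difference pV \<sigma>_less by (auto simp: q_def h_def)
  have q_prod: "finprod R q ?J = \<one>"
  proof -
    have qc: "q \<in> Inl ` {..<l} \<rightarrow> carrier R" "q \<in> Inr ` {..<l} \<rightarrow> carrier R"
      using c \<sigma>_less by (auto simp: q_def)
    have "finprod R q ?J = finprod R q (Inl ` {..<l}) \<otimes> finprod R q (Inr ` {..<l})"
      unfolding Plus_def using qc by (intro finprod_Un_disjoint) auto
    also have "\<dots> = finprod R (\<lambda>i. x i \<otimes> inv y i) {..<l} \<otimes> finprod R (\<lambda>i. y i \<otimes> inv x (\<sigma> i)) {..<l}"
      using qc by (simp add: finprod_reindex q_def)
    also have "\<dots> = \<one>" using c bij by (intro finprod_cyclic_differences) auto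
    finally show ?thesis .
  qed
  have YX: "?Y \<subseteq> X" using cyc(1) by (simp add: cycle_of_length_def subgraph_def)
  have S: "\<one> \<in> S z \<and> S z \<subseteq> carrier R" if "z \<in> ?Y" for z using that YX S_closed by blast
  have one: "q j = \<one>" if "j \<in> ?J" for j
    by (rule linearly_disjoint_eq_one[OF ld _ S h_inj h_Y q_S q_prod that]) auto
  have step: "x (\<sigma> i) = x i" if i: "i < l" for i
  proof -
    have "x i \<otimes> inv y i = \<one>" "y i \<otimes> inv x (\<sigma> i) = \<one>"
      using one[OF InlI[of i]] one[OF InrI[of i]] i by (simp_all add: q_def)
    then have "x i = y i" "y i = x (\<sigma> i)" using c i \<sigma>_less eq_if_mult_inv_eq_one by metis+
    then show ?thesis by simp
  qed
  have const: "x i = x 0" if "i < l" for i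
    using that
  proof (induction i)
    case (Suc i)
    then show ?case using step[of i] \<sigma>_Suc[of i] by simp
  qed simp
  have "x 0 \<in> L v" if "v \<in> set p" for v
    using that xy(1) const by (metis in_set_conv_nth l_def)
  then show ?thesis by blast
qed

lemma list_graph: "list_graph V Good L"
proof
  show "finite V" by (rule finite_V)
  show "e \<subseteq> V \<and> card e = 2" if "e \<in> Good" for e using that Good_subset edge by blast
qed (fact L_cycle, fact L_unique)

lemma cochain_norm_d0: "cochain_norm X w F 1 (d0 X F f) = (\<Sum>e\<in>Es - Good. w e)"
  unfolding cochain_norm_def by (rule sum.cong) (auto simp: Es_def Good_def)

lemma dist_B0_le:
  assumes g: "g \<in> carrier R"
  shows "dist_B0 X w F f \<le> Wt {v \<in> V. g \<notin> L v}"
proof -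
  let ?P = "cochains X F 0"
  define d where "d = d_minus1 X F (G {} #> g)"
  have d_v: "d {v} = G {v} #> g" if "v \<in> V" for v
    using that res_F[OF empty_in_X singleton_in_X[OF that] _ g]
    by (simp add: d_def d_minus1_def vertex_faces)
  have "d \<in> B0 X F" using g by (auto simp: B0_def d_def grp_F carrier_FactGroup)
  moreover have "finite ((\<lambda>c. cochain_norm X w F 0 (f \<otimes>\<^bsub>?P\<^esub> inv\<^bsub>?P\<^esub> c)) ` B0 X F)"
    using finite_cochain_norm_image[OF graph_X, of w F 0 "(\<lambda>c. f \<otimes>\<^bsub>?P\<^esub> inv\<^bsub>?P\<^esub> c) ` B0 X F"]
    by (simp add: image_image)
  ultimately have "dist_B0 X w F f \<le> cochain_norm X w F 0 (f \<otimes>\<^bsub>?P\<^esub> inv\<^bsub>?P\<^esub> d)"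
    unfolding dist_B0_def by (intro Min_le) auto
  also have "\<dots> \<le> (\<Sum>x\<in>(\<lambda>v. {v}) ` {v \<in> V. g \<notin> L v}. w x)"
    unfolding cochain_norm_def
  proof (rule sum_mono2)
    show "finite ((\<lambda>v. {v}) ` {v \<in> V. g \<notin> L v})" using finite_V by simp
    show "0 \<le> w x" if "x \<in> (\<lambda>v. {v}) ` {v \<in> V. g \<notin> L v} -
        {x \<in> faces X 0. (f \<otimes>\<^bsub>?P\<^esub> inv\<^bsub>?P\<^esub> d) x \<noteq> \<one>\<^bsub>grp F x\<^esub>}" for x
      using that W_pos by (auto simp: W_def less_imp_le)
    show "{x \<in> faces X 0. (f \<otimes>\<^bsub>?P\<^esub> inv\<^bsub>?P\<^esub> d) x \<noteq> \<one>\<^bsub>grp F x\<^esub>} \<subseteq> (\<lambda>v. {v}) ` {v \<in> V. g \<notin> L v}"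
    proof
      fix x assume x: "x \<in> {x \<in> faces X 0. (f \<otimes>\<^bsub>?P\<^esub> inv\<^bsub>?P\<^esub> d) x \<noteq> \<one>\<^bsub>grp F x\<^esub>}"
      then obtain v where v: "v \<in> V" "x = {v}" by (auto simp: vertex_faces)
      have grp: "group (grp F y)" if "y \<in> faces X 0" for y
        using group_F that by (simp add: faces_def)
      have "d \<in> carrier ?P"
        using g d_v by (auto simp: cochains_def vertex_faces grp_F carrier_FactGroup d_def d_minus1_def PiE_iff)
      then have inv_d: "inv\<^bsub>?P\<^esub> d = (\<lambda>y\<in>faces X 0. inv\<^bsub>grp F y\<^esub> d y)"
        unfolding cochains_def by (intro inv_product_group) (auto intro: grp)
      have "g \<notin> L v"
      proof
        assume "g \<in> L v"
        then have fd: "f {v} = d {v}" using L_eq_coset v d_v G_vertex by (simp add: L_def)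
        have "{v} \<in> faces X 0" using v by (simp add: vertex_faces)
        moreover from this have "f {v} \<in> carrier (grp F {v})" using f by (auto simp: cochains_def PiE_iff)
        ultimately have "(f \<otimes>\<^bsub>?P\<^esub> inv\<^bsub>?P\<^esub> d) {v} = \<one>\<^bsub>grp F {v}\<^esub>"
          using fd group.r_inv[OF grp] by (simp add: inv_d) (simp add: cochains_def)
        then show False using x v by simp
      qed
      then show "x \<in> (\<lambda>v. {v}) ` {v \<in> V. g \<notin> L v}" using v by blast
    qed
  qed
  also have "\<dots> = Wt {v \<in> V. g \<notin> L v}"
    unfolding Wt_def by (subst sum.reindex) (auto simp: W_def)
  finally show ?thesis .
qed

end

section \<open>The coboundary expansion bound\<close>

theorem theorem6p1:
  fixes X :: "('a::linorder) set set" and w :: "'a set \<Rightarrow> real"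
    and R :: "'r monoid" and S :: "'a set \<Rightarrow> 'r set" and G :: "'a set \<Rightarrow> 'r set"
    and n :: nat and t s \<mu> \<kappa> :: real
  assumes "weighted_graph X w"
    and "n = card (faces X 0)"
    and "comm_group R"
    and "\<And>x. x \<in> X \<Longrightarrow> x \<noteq> {} \<Longrightarrow> subgroup (S x) R"
    and "S {} = {\<one>\<^bsub>R\<^esub>}"
    and "G = (\<lambda>x. subgroup_sum R S {y \<in> X. y \<subseteq> x})"
    and "t = Max {w e / w x |x e. x \<in> faces X 0 \<and> e \<in> faces X 1 \<and> x \<subseteq> e}"
    and "s = Max {w e |e. e \<in> faces X 1}"
    and "\<And>Y. (\<exists>l. cycle_of_length X l Y \<and> int l \<le> \<lceil>2 / 3 * real n\<rceil>) \<or>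
              (\<exists>l\<le>2. path_of_length X l Y) \<Longrightarrow> linearly_disjoint R S Y"
    and "\<And>u v. u \<in> faces X 0 \<Longrightarrow> v \<in> faces X 0 \<Longrightarrow> u \<noteq> v \<Longrightarrow> linearly_disjoint R S {u, v}"
    and "spectral_expander X w \<mu> \<kappa>"
    and "\<kappa> < 5 / 2"
  shows "cbe0 X w (quotient_sheaf (const_sheaf R) G)
           \<ge> ereal ((2 - 4 * \<kappa> - 4 * max \<bar>\<kappa>\<bar> \<bar>\<mu>\<bar> - 5 * t - 2 * s) / (5 - 2 * \<kappa>))"
proof -
  let ?F = "quotient_sheaf (const_sheaf R) G :: ('a, 'r set) sheaf_data"
  define \<epsilon> where "\<epsilon> = (2 - 4 * \<kappa> - 4 * max \<bar>\<kappa>\<bar> \<bar>\<mu>\<bar> - 5 * t - 2 * s) / (5 - 2 * \<kappa>)"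
  define c where "c = max 0 \<epsilon>"
  interpret wgraph X w by unfold_locales fact
  interpret comm_group R by fact
  have n: "n = card V" using assms(2) by (simp add: vertex_faces card_image)
  have w_le: "w e \<le> t * W v" if e: "e \<in> Es" "v \<in> e" for e v
  proof -
    have v: "v \<in> V" using e edge by blast
    have "finite {w e / w x |x e. x \<in> faces X 0 \<and> e \<in> faces X 1 \<and> x \<subseteq> e}"
    proof (rule finite_subset)
      show "finite ((\<lambda>(x, e). w e / w x) ` (X \<times> X))" using finite_X by simp
      show "{w e / w x |x e. x \<in> faces X 0 \<and> e \<in> faces X 1 \<and> x \<subseteq> e} \<subseteq>
          (\<lambda>(x, e). w e / w x) ` (X \<times> X)"
      proof clarify
        fix x e assume "x \<in> faces X 0" "e \<in> faces X 1"
        then show "w e / w x \<in> (\<lambda>(x, e). w e / w x) ` (X \<times> X)"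
          by (intro image_eqI[of _ _ "(x, e)"]) (simp_all add: faces_def)
      qed
    qed
    moreover have "{v} \<in> faces X 0 \<and> e \<in> faces X 1 \<and> {v} \<subseteq> e"
      using e v by (simp add: vertex_faces Es_def)
    then have "w e / w {v} \<in> {w e / w x |x e. x \<in> faces X 0 \<and> e \<in> faces X 1 \<and> x \<subseteq> e}"
      by blast
    ultimately have "w e / w {v} \<le> t" unfolding assms(7) by (rule Max_ge)
    then show ?thesis using W_pos[OF v] by (simp add: W_def field_simps)
  qed
  have "Es \<noteq> {}" using sum_w by auto
  then obtain e0 where e0: "e0 \<in> Es" by blast
  then have "e0 \<noteq> {}" "e0 \<subseteq> V" using edge[OF e0] by auto
  then obtain v0 where v0: "v0 \<in> e0" "v0 \<in> V" by blast
  have t0: "0 \<le> t"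
    using order_trans[OF w_nonneg[OF e0] w_le[OF e0 v0(1)]] W_pos[OF v0(2)] by (simp add: zero_le_mult_iff)
  have "w e0 \<le> s"
    unfolding assms(8) using e0 finite_Es by (intro Max_ge) (auto simp: Es_def)
  then have s0: "0 \<le> s" using w_nonneg[OF e0] by simp
  have main: "c * dist_B0 X w ?F f \<le> cochain_norm X w ?F 1 (d0 X ?F f)"
    if f: "f \<in> carrier (cochains X ?F 0)" for f
  proof (cases "\<epsilon> \<le> 0")
    case True
    have "0 \<le> cochain_norm X w ?F 1 (d0 X ?F f)"
      unfolding cochain_norm_def by (rule sum_nonneg) (use w_nonneg in \<open>simp add: Es_def\<close>)
    then show ?thesis using True by (simp add: c_def)
  next
    case False
    interpret coset_cochain X w R S f G ?F
    proof (intro coset_cochain.intro coset_cochain_axioms.intro)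
      show "wgraph X w" "comm_group R" by unfold_locales
      show "subgroup (S x) R" if "x \<in> X" "x \<noteq> {}" for x using that by (rule assms(4))
      show "linearly_disjoint R S Y" if "cycle_of_length X l Y" "3 * l \<le> 2 * (card V + 1)" for l Y
      proof -
        have "real l - 1 < 2 / 3 * real n" using that(2) n by simp
        then have "int l \<le> \<lceil>2 / 3 * real n\<rceil>" by (simp add: le_ceiling_iff)
        then show ?thesis using assms(9) that(1) by blast
      qed
      show "linearly_disjoint R S Y" if "path_of_length X 2 Y" for Y
        using assms(9) that by blast
      show "linearly_disjoint R S {{u}, {v}}" if "u \<in> V" "v \<in> V" "u \<noteq> v" for u v
        using assms(10) that by (simp add: vertex_faces)
    qed (fact assms(5) assms(6) refl f)+
    define l where "l = max \<kappa> 0"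
    have num: "0 < \<epsilon> * (5 - 2 * \<kappa>)" using False assms(12) by simp
    have l1: "l \<le> 1"
    proof -
      have "\<epsilon> * (5 - 2 * \<kappa>) = 2 - 4 * \<kappa> - 4 * max \<bar>\<kappa>\<bar> \<bar>\<mu>\<bar> - 5 * t - 2 * s"
        using assms(12) by (simp add: \<epsilon>_def)
      moreover have "0 \<le> max \<bar>\<kappa>\<bar> \<bar>\<mu>\<bar>" by simp
      ultimately have "\<kappa> \<le> 1" using num t0 s0 by linarith
      then show ?thesis by (simp add: l_def)
    qed
    interpret wgraph_lists X w Good L "carrier R" t \<mu> \<kappa> l
    proof (intro wgraph_lists.intro wgraph_lists_axioms.intro)
      show "wgraph X w" by unfold_locales
      show "list_graph V Good L" by (rule list_graph)
      show "g \<in> L v" if "{u, v} \<in> Good" "{v, u'} \<in> Good" "u \<noteq> u'" "g \<in> L u" "g \<in> L u'" for u v u' g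
        using that by (rule L_path)
      show "w e \<le> t * W v" if "e \<in> Es" "v \<in> e" for e v
        using that by (rule w_le)
      show "carrier R \<noteq> {}" using one_closed by blast
    qed (simp_all add: Good_subset t0 L_carrier assms(11) l1, simp_all add: l_def)
    obtain g where g: "g \<in> carrier R"
        "(1 - l) * Wt (V - agree g) \<le> (\<Sum>e\<in>Es - Good. w e) + t"
        "2 * (1 - l) * (1 - Wt (V - agree g)) * Wt (V - agree g) - t * Wt (V - agree g) \<le> (\<Sum>e\<in>Es - Good. w e)"
      using ex_close_constant by blast
    have "\<epsilon> * Wt (V - agree g) \<le> (\<Sum>e\<in>Es - Good. w e)"
      by (rule expansion_arith[OF _ \<epsilon>_def _ assms(12) t0 s0 Wt_nonneg Wt_le_1 l_def g(2,3)]) (use False in auto)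
    moreover have "V - agree g = {v \<in> V. g \<notin> L v}" by (auto simp: agree_def)
    ultimately have "\<epsilon> * Wt {v \<in> V. g \<notin> L v} \<le> cochain_norm X w ?F 1 (d0 X ?F f)"
      by (simp only: cochain_norm_d0)
    moreover have "\<epsilon> * dist_B0 X w ?F f \<le> \<epsilon> * Wt {v \<in> V. g \<notin> L v}"
      using dist_B0_le[OF g(1)] False by (intro mult_left_mono) auto
    ultimately have "\<epsilon> * dist_B0 X w ?F f \<le> cochain_norm X w ?F 1 (d0 X ?F f)" by linarith
    moreover have "c = \<epsilon>" using False by (simp add: c_def)
    ultimately show ?thesis by (simp only:)
  qed
  have "ereal c \<le> cbe0 X w ?F"
    unfolding cbe0_def
  proof (rule Sup_upper, intro CollectI exI conjI ballI)
    show "0 \<le> c" by (simp add: c_def)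
  qed (rule refl, rule main)
  moreover have "ereal \<epsilon> \<le> ereal c" by (simp add: c_def)
  ultimately show ?thesis unfolding \<epsilon>_def by (rule order_trans[rotated])
qed

end
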